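(* Let $\mathbb{K}$ be an algebraically closed field and let $Q$ be a finite, connected, acyclic quiver with $n>1$ vertices. Let $A=\mathbb{K}Q$ be its path algebra and let $B=\bigoplus_{a}\mathbb{K}\varepsilon_a\cong\mathbb{K}^n$ be the subalgebra spanned by the stationary paths $\varepsilon_a$, $a$ ranging over the vertices of $Q$ (so $B\cong A/\operatorname{rad}A$; the "top subalgebra" or subalgebra of diagonal matrices). Then the minimum depth is $d(B,A)=3$.
   Context: Path algebra: $A=\mathbb{K}Q$ has as basis all oriented paths in $Q$, including a stationary path $\varepsilon_a$ of length $0$ at each vertex $a$; the product of a path from $a$ to $b$ with a path from $c$ to $d$ (in this order) is their concatenation if $b=c$ and $0$ otherwise. Acyclic means no loops and no oriented cycles; finite means finitely many vertices and arrows (multiple arrows are allowed); connected refers to the underlying graph. Depth: for modules over a ring, $M\mid N$ means $N\cong M\oplus M'$ for some module $M'$, and $M\sim N$ (H-equivalent) means there are natural numbers $r,s\ge 1$ with $N\mid rM$ and $M\mid sN$, where $rM=M\oplus\cdots\oplus M$ ($r$ times). For a unital subring $B\subseteq A$ with $1_B=1_A$, put $C_0(A,B)=B$ (as a $B$-$B$-bimodule) and $C_m(A,B)=A\otimes_B\cdots\otimes_B A$ ($m$ factors $A$) for $m\ge1$, with its natural $A$-$A$-bimodule structure $a(a_1\otimes\cdots\otimes a_m)a'=aa_1\otimes\cdots\otimes a_ma'$ and its restrictions to $A$-$B$-, $B$-$A$-, $B$-$B$-bimodules. The subring $B\subseteq A$ has depth $2m+1$ ($m\ge0$) if $C_{m+1}(A,B)\sim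 C_m(A,B)$ as $B$-$B$-bimodules; right (resp. left) depth $2m$ ($m\ge1$) if $C_{m+1}(A,B)\sim C_m(A,B)$ as $A$-$B$-bimodules (resp. $B$-$A$-bimodules); depth $2m$ if it has both left and right depth $2m$. Left or right depth $2m$ implies depth $2m+1$, and depth $2m+1$ implies depth $2m+2$. The minimum depth $d(B,A)$ is the least $k\ge 1$ such that $k$ is odd and $B\subseteq A$ has depth $k$, or $k$ is even and $B\subseteq A$ has left or right depth $k$; $d(B,A)=\infty$ if there is no such $k$. *)

theory Defs
  imports
    "HOL-Algebra.Algebra"
    "HOL-Library.Extended_Nat"
    "HOL-Computational_Algebra.Polynomial"
    "Graph_Theory.Graph_Theory"
begin

section \<open>Bimodules\<close>

text \<open>
  The additive group of a bimodule is stored in the fields of a (multiplicatively written)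
  monoid record, so that the library's \<open>iso\<close>, \<open>\<times>\<times>\<close>, \<open>product_group\<close>, \<open>Mod\<close> and
  \<open>free_Abelian_group\<close> apply to it: \<open>x \<otimes>\<^bsub>M\<^esub> y\<close> is the sum of \<open>x\<close> and \<open>y\<close>, and \<open>\<one>\<^bsub>M\<^esub>\<close> is the
  zero of \<open>M\<close>.
\<close>

record ('r, 's, 'm) bimodule = "'m monoid" +
  lact :: "'r \<Rightarrow> 'm \<Rightarrow> 'm"
  ract :: "'m \<Rightarrow> 's \<Rightarrow> 'm"

locale bimodule = R?: ring R + S?: ring S + M?: comm_group M
  for R :: "('r, 'x) ring_scheme" and S :: "('s, 'y) ring_scheme"
    and M :: "('r, 's, 'm, 'z) bimodule_scheme" +
  assumes lact_closed: "\<lbrakk>r \<in> carrier R; x \<in> carrier M\<rbrakk> \<Longrightarrow> lact M r x \<in> carrier M"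
    and ract_closed: "\<lbrakk>s \<in> carrier S; x \<in> carrier M\<rbrakk> \<Longrightarrow> ract M x s \<in> carrier M"
    and lact_add_left: "\<lbrakk>r \<in> carrier R; r' \<in> carrier R; x \<in> carrier M\<rbrakk>
      \<Longrightarrow> lact M (r \<oplus>\<^bsub>R\<^esub> r') x = lact M r x \<otimes>\<^bsub>M\<^esub> lact M r' x"
    and lact_add_right: "\<lbrakk>r \<in> carrier R; x \<in> carrier M; y \<in> carrier M\<rbrakk>
      \<Longrightarrow> lact M r (x \<otimes>\<^bsub>M\<^esub> y) = lact M r x \<otimes>\<^bsub>M\<^esub> lact M r y"
    and ract_add_right: "\<lbrakk>s \<in> carrier S; s' \<in> carrier S; x \<in> carrier M\<rbrakk>
      \<Longrightarrow> ract M x (s \<oplus>\<^bsub>S\<^esub> s') = ract M x s \<otimes>\<^bsub>M\<^esub> ract M x s'"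
    and ract_add_left: "\<lbrakk>s \<in> carrier S; x \<in> carrier M; y \<in> carrier M\<rbrakk>
      \<Longrightarrow> ract M (x \<otimes>\<^bsub>M\<^esub> y) s = ract M x s \<otimes>\<^bsub>M\<^esub> ract M y s"
    and lact_mult: "\<lbrakk>r \<in> carrier R; r' \<in> carrier R; x \<in> carrier M\<rbrakk>
      \<Longrightarrow> lact M (r \<otimes>\<^bsub>R\<^esub> r') x = lact M r (lact M r' x)"
    and ract_mult: "\<lbrakk>s \<in> carrier S; s' \<in> carrier S; x \<in> carrier M\<rbrakk>
      \<Longrightarrow> ract M x (s \<otimes>\<^bsub>S\<^esub> s') = ract M (ract M x s) s'"
    and lact_one: "x \<in> carrier M \<Longrightarrow> lact M \<one>\<^bsub>R\<^esub> x = x"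
    and ract_one: "x \<in> carrier M \<Longrightarrow> ract M x \<one>\<^bsub>S\<^esub> = x"
    and lact_ract: "\<lbrakk>r \<in> carrier R; s \<in> carrier S; x \<in> carrier M\<rbrakk>
      \<Longrightarrow> ract M (lact M r x) s = lact M r (ract M x s)"

text \<open>
  The actions of a bimodule record are total functions. Only the scalars in the carriers of the
  ring arguments \<open>R\<close> and \<open>S\<close> are taken into account below, so a single record is also used for
  all restrictions of a bimodule to subrings.
\<close>

definition bimod_isomorphic ::
  "('r, 'x) ring_scheme \<Rightarrow> ('s, 'y) ring_scheme \<Rightarrow> ('r, 's, 'm) bimodule \<Rightarrow> ('r, 's, 'n) bimodule \<Rightarrow> bool"
where
  "bimod_isomorphic R S M N \<longleftrightarrow> (\<exists>h \<in> iso M N. \<forall>x \<in> carrier M.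
      (\<forall>r \<in> carrier R. h (lact M r x) = lact N r (h x)) \<and>
      (\<forall>s \<in> carrier S. h (ract M x s) = ract N (h x) s))"

definition direct_sum ::
  "('r, 's, 'm) bimodule \<Rightarrow> ('r, 's, 'n) bimodule \<Rightarrow> ('r, 's, 'm \<times> 'n) bimodule"
where
  "direct_sum M N =
    \<lparr>carrier = carrier (M \<times>\<times> N), monoid.mult = monoid.mult (M \<times>\<times> N), one = \<one>\<^bsub>M \<times>\<times> N\<^esub>,
     lact = (\<lambda>r (x, y). (lact M r x, lact N r y)),
     ract = (\<lambda>(x, y) s. (ract M x s, ract N y s))\<rparr>"

definition copies :: "nat \<Rightarrow> ('r, 's, 'm) bimodule \<Rightarrow> ('r, 's, nat \<Rightarrow> 'm) bimodule"
where
  "copies k M = (let P = product_group {..<k} (\<lambda>_. M) in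
    \<lparr>carrier = carrier P, monoid.mult = monoid.mult P, one = \<one>\<^bsub>P\<^esub>,
     lact = (\<lambda>r x. \<lambda>i\<in>{..<k}. lact M r (x i)),
     ract = (\<lambda>x s. \<lambda>i\<in>{..<k}. ract M (x i) s)\<rparr>)"

text \<open>
  \<open>M | N\<close>. The complement \<open>M'\<close> may be taken over the element type of \<open>N\<close> without loss of
  generality, because it is isomorphic to a sub-bimodule of \<open>N\<close>.
\<close>

definition bimod_divides ::
  "('r, 'x) ring_scheme \<Rightarrow> ('s, 'y) ring_scheme \<Rightarrow> ('r, 's, 'm) bimodule \<Rightarrow> ('r, 's, 'n) bimodule \<Rightarrow> bool"
where
  "bimod_divides R S M N \<longleftrightarrow>
    (\<exists>M' :: ('r, 's, 'n) bimodule. bimodule R S M' \<and> bimod_isomorphic R S N (direct_sum M M'))"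

definition H_equivalent ::
  "('r, 'x) ring_scheme \<Rightarrow> ('s, 'y) ring_scheme \<Rightarrow> ('r, 's, 'm) bimodule \<Rightarrow> ('r, 's, 'n) bimodule \<Rightarrow> bool"
where
  "H_equivalent R S M N \<longleftrightarrow>
    (\<exists>r\<ge>1. bimod_divides R S N (copies r M)) \<and> (\<exists>s\<ge>1. bimod_divides R S M (copies s N))"


section \<open>Tensor powers of a ring over a subring\<close>

definition regular_bimodule :: "('a, 'c) ring_scheme \<Rightarrow> ('a, 'a, 'a) bimodule"
where
  "regular_bimodule A =
    \<lparr>carrier = carrier A, monoid.mult = add A, one = \<zero>\<^bsub>A\<^esub>, lact = monoid.mult A, ract = monoid.mult A\<rparr>"

text \<open>
  For \<open>m \<ge> 1\<close>, \<open>A \<otimes>\<^sub>B \<dots> \<otimes>\<^sub>B A\<close> with \<open>m\<close> factors is the quotient of the free abelian group on the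
  \<open>m\<close>-tuples over \<open>A\<close> by additivity in each position and \<open>B\<close>-balancedness between any two
  neighbouring positions. The tensor \<open>a\<^sub>1 \<otimes> \<dots> \<otimes> a\<^sub>m\<close> is the coset of the generator
  \<open>frag_of [a\<^sub>1, \<dots>, a\<^sub>m]\<close>.
\<close>

definition tuples_group :: "('a, 'c) ring_scheme \<Rightarrow> nat \<Rightarrow> ('a list \<Rightarrow>\<^sub>0 int) monoid"
where
  "tuples_group A m = free_Abelian_group {as \<in> lists (carrier A). length as = m}"

definition tensor_relators :: "('a, 'c) ring_scheme \<Rightarrow> 'a set \<Rightarrow> nat \<Rightarrow> ('a list \<Rightarrow>\<^sub>0 int) set"
where
  "tensor_relators A B m =
    {frag_of (us @ (x \<oplus>\<^bsub>A\<^esub> y) # vs) - frag_of (us @ x # vs) - frag_of (us @ y # vs) | us x y vs.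
       us \<in> lists (carrier A) \<and> vs \<in> lists (carrier A) \<and> x \<in> carrier A \<and> y \<in> carrier A \<and>
       length us + 1 + length vs = m} \<union>
    {frag_of (us @ (x \<otimes>\<^bsub>A\<^esub> b) # y # vs) - frag_of (us @ x # (b \<otimes>\<^bsub>A\<^esub> y) # vs) | us x b y vs.
       us \<in> lists (carrier A) \<and> vs \<in> lists (carrier A) \<and> x \<in> carrier A \<and> y \<in> carrier A \<and>
       b \<in> B \<and> length us + 2 + length vs = m}"

definition tensor_power :: "('a, 'c) ring_scheme \<Rightarrow> 'a set \<Rightarrow> nat \<Rightarrow> ('a, 'a, ('a list \<Rightarrow>\<^sub>0 int) set) bimodule"
where
  "tensor_power A B m = (let F = tuples_group A m; N = generate F (tensor_relators A B m) in
    \<lparr>carrier = carrier (F Mod N), monoid.mult = monoid.mult (F Mod N), one = \<one>\<^bsub>F Mod N\<^esub>,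
     lact = (\<lambda>a U. \<Union>x\<in>U. N #>\<^bsub>F\<^esub> frag_extend (\<lambda>as. frag_of ((a \<otimes>\<^bsub>A\<^esub> hd as) # tl as)) x),
     ract = (\<lambda>U a. \<Union>x\<in>U. N #>\<^bsub>F\<^esub> frag_extend (\<lambda>as. frag_of (butlast as @ [last as \<otimes>\<^bsub>A\<^esub> a])) x)\<rparr>)"


section \<open>Minimum depth\<close>

text \<open>
  \<open>C_similar A B R S m\<close> says that \<open>C\<^sub>m\<^sub>+\<^sub>1(A, B) \<sim> C\<^sub>m(A, B)\<close> as \<open>R\<close>-\<open>S\<close>-bimodules. The case \<open>m = 0\<close> is
  separate because \<open>C\<^sub>0(A, B) = B\<close> has another element type than the tensor powers; it is only
  meaningful for \<open>R = S = B\<close>.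
\<close>

definition C_similar ::
  "('a, 'c) ring_scheme \<Rightarrow> 'a set \<Rightarrow> ('a, 'x) ring_scheme \<Rightarrow> ('a, 'y) ring_scheme \<Rightarrow> nat \<Rightarrow> bool"
where
  "C_similar A B R S m \<longleftrightarrow>
    (if m = 0 then H_equivalent R S (tensor_power A B 1) (regular_bimodule (A\<lparr>carrier := B\<rparr>))
     else H_equivalent R S (tensor_power A B (m + 1)) (tensor_power A B m))"

definition has_odd_depth :: "('a, 'c) ring_scheme \<Rightarrow> 'a set \<Rightarrow> nat \<Rightarrow> bool"
where
  "has_odd_depth A B k \<longleftrightarrow>
    (\<exists>m. k = 2 * m + 1 \<and> C_similar A B (A\<lparr>carrier := B\<rparr>) (A\<lparr>carrier := B\<rparr>) m)"

definition has_right_even_depth :: "('a, 'c) ring_scheme \<Rightarrow> 'a set \<Rightarrow> nat \<Rightarrow> bool"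
where
  "has_right_even_depth A B k \<longleftrightarrow> (\<exists>m\<ge>1. k = 2 * m \<and> C_similar A B A (A\<lparr>carrier := B\<rparr>) m)"

definition has_left_even_depth :: "('a, 'c) ring_scheme \<Rightarrow> 'a set \<Rightarrow> nat \<Rightarrow> bool"
where
  "has_left_even_depth A B k \<longleftrightarrow> (\<exists>m\<ge>1. k = 2 * m \<and> C_similar A B (A\<lparr>carrier := B\<rparr>) A m)"

text \<open>\<open>d(B, A)\<close> for a unital subring \<open>B\<close> of \<open>A\<close>; the infimum of the empty set is \<open>\<infinity>\<close>.\<close>

definition min_depth :: "'a set \<Rightarrow> ('a, 'c) ring_scheme \<Rightarrow> enat"
where
  "min_depth B A =
    Inf (enat ` {k. has_odd_depth A B k \<or> has_left_even_depth A B k \<or> has_right_even_depth A B k})"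


section \<open>Path algebras\<close>

text \<open>
  A quiver is a digraph; the library's \<open>pre_digraph\<close> admits loops and parallel arcs. A path is stored as its start
  vertex, its list of arcs and its end vertex, so the stationary path at \<open>a\<close> is \<open>(a, [], a)\<close>.
  An element of the path algebra is a finitely supported coefficient function on paths.
\<close>

type_synonym ('v, 'e) path = "'v \<times> 'e list \<times> 'v"

definition paths :: "('v, 'e) pre_digraph \<Rightarrow> ('v, 'e) path set"
where
  "paths Q = {(a, p, b). pre_digraph.awalk Q a p b}"

definition stationary :: "'v \<Rightarrow> ('v, 'e) path \<Rightarrow>\<^sub>0 'k::field"
where
  "stationary a = Poly_Mapping.single (a, [], a) 1"

definition path_mult ::
  "(('v, 'e) path \<Rightarrow>\<^sub>0 'k::field) \<Rightarrow> (('v, 'e) path \<Rightarrow>\<^sub>0 'k) \<Rightarrow> (('v, 'e) path \<Rightarrow>\<^sub>0 'k)"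
where
  "path_mult f g = (\<Sum>(a, p, b) \<in> Poly_Mapping.keys f. \<Sum>(c, q, d) \<in> Poly_Mapping.keys g.
     if b = c
     then Poly_Mapping.single (a, p @ q, d)
            (Poly_Mapping.lookup f (a, p, b) * Poly_Mapping.lookup g (c, q, d))
     else 0)"

definition path_algebra :: "('v, 'e) pre_digraph \<Rightarrow> (('v, 'e) path \<Rightarrow>\<^sub>0 'k::field) ring"
where
  "path_algebra Q =
    \<lparr>carrier = {f. Poly_Mapping.keys f \<subseteq> paths Q}, monoid.mult = path_mult,
     one = (\<Sum>a\<in>verts Q. stationary a), ring.zero = 0, add = (+)\<rparr>"

definition top_subalgebra :: "('v, 'e) pre_digraph \<Rightarrow> (('v, 'e) path \<Rightarrow>\<^sub>0 'k::field) set"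
where
  "top_subalgebra Q =
    {(\<Sum>a\<in>verts Q. Poly_Mapping.single (a, [], a) (c a)) | c :: 'v \<Rightarrow> 'k. True}"

end

theory Submission
  imports Defs
begin

text \<open>
  A bimodule \<open>M\<close> divides \<open>kN\<close> iff the identity of \<open>M\<close> is a sum of \<open>k\<close> endomorphisms that factor through \<open>N\<close>.

  Depth 3: \<open>A\<close> divides \<open>A \<otimes>\<^sub>B A\<close> by the unit and the multiplication. Conversely, the identity of
  \<open>A \<otimes>\<^sub>B A\<close> is the sum over all pairs of paths \<open>p\<close>, \<open>q\<close> of the projections to \<open>K (p \<otimes> q)\<close>; such a
  projection is zero or factors through \<open>K pq \<subseteq> A\<close>, and there are finitely many paths.

  Smaller depths fail because of a single arrow \<open>\<alpha>\<close> from \<open>i\<close> to \<open>j \<noteq> i\<close>. Depth 1: \<open>\<epsilon>\<^sub>i A \<epsilon>\<^sub>j \<noteq> 0 = \<epsilon>\<^sub>i B \<epsilon>\<^sub>j\<close>.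
  Right depth 2: let \<open>F (x \<otimes> y) = x P(y)\<close>, where \<open>P\<close> projects \<open>A\<close> to \<open>K \<alpha>\<close>. For an \<open>A\<close>-\<open>B\<close>-linear map
  \<open>g : A \<rightarrow> A \<otimes>\<^sub>B A\<close> the element \<open>F (g \<epsilon>\<^sub>j)\<close> lies in \<open>\<epsilon>\<^sub>j A \<alpha>\<close>, which is \<open>0\<close>
  because \<open>Q\<close> is acyclic, so \<open>F \<circ> g\<close> vanishes on \<open>A \<epsilon>\<^sub>j\<close>. Hence \<open>F\<close> vanishes on every sum of values at \<open>1 \<otimes> \<alpha> = (1 \<otimes> \<alpha>) \<epsilon>\<^sub>j\<close> of maps that factor through \<open>A\<close>,
  whereas \<open>F (1 \<otimes> \<alpha>) = \<alpha>\<close>. Left depth 2 is symmetric.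
\<close>

section \<open>Direct summands of bimodules\<close>

text \<open>The tensor powers are quotients of free abelian groups by relators, with no basis at
  hand. So maps out of them are built from values on pure tensors by the universal property,
  identities between such maps are checked on pure tensors, and an element is recognized as nonzero
  by mapping it to \<open>A\<close>. The map F of the overview is such a detector: it is id tensor P
  followed by multiplication. It is well defined and A-B-linear because P commutes with both actions
  of B: a diagonal element scales a path by its entry at the start from the left, and by its entry
  at the end from the right. The relators balance only over B, but B contains the scalar multiples
  of 1. So field scalars move across the tensor sign. A path of length l is a product of two paths
  in l + 1 ways, so multiplication is far from injective on A tensor A. Therefore the projection to
  a pair (p, q) is applied before multiplying, and each pair gets its own map back. This costs one
  copy of A per pair of paths.\<close>

definition bimod_hom ::
  "('r, 'x) ring_scheme \<Rightarrow> ('s, 'y) ring_scheme \<Rightarrow> ('r, 's, 'm, 'z) bimodule_scheme \<Rightarrow>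
    ('r, 's, 'n, 'w) bimodule_scheme \<Rightarrow> ('m \<Rightarrow> 'n) set"
where
  "bimod_hom R S M N = {h \<in> hom M N. \<forall>x \<in> carrier M.
      (\<forall>r \<in> carrier R. h (lact M r x) = lact N r (h x)) \<and>
      (\<forall>s \<in> carrier S. h (ract M x s) = ract N (h x) s)}"

lemma bimod_homI:
  assumes "h \<in> hom M N"
    and "\<And>r x. r \<in> carrier R \<Longrightarrow> x \<in> carrier M \<Longrightarrow> h (lact M r x) = lact N r (h x)"
    and "\<And>s x. s \<in> carrier S \<Longrightarrow> x \<in> carrier M \<Longrightarrow> h (ract M x s) = ract N (h x) s"
  shows "h \<in> bimod_hom R S M N"
  using assms by (simp add: bimod_hom_def)

lemma bimod_homD:
  assumes "h \<in> bimod_hom R S M N"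
  shows bimod_hom_hom: "h \<in> hom M N"
    and bimod_hom_closed: "x \<in> carrier M \<Longrightarrow> h x \<in> carrier N"
    and bimod_hom_add: "x \<in> carrier M \<Longrightarrow> y \<in> carrier M \<Longrightarrow> h (x \<otimes>\<^bsub>M\<^esub> y) = h x \<otimes>\<^bsub>N\<^esub> h y"
    and bimod_hom_lact: "r \<in> carrier R \<Longrightarrow> x \<in> carrier M \<Longrightarrow> h (lact M r x) = lact N r (h x)"
    and bimod_hom_ract: "s \<in> carrier S \<Longrightarrow> x \<in> carrier M \<Longrightarrow> h (ract M x s) = ract N (h x) s"
  using assms by (auto simp: bimod_hom_def hom_def)

lemma bimod_hom_comp:
  assumes "f \<in> bimod_hom R S M N" "g \<in> bimod_hom R S N P"
  shows "(\<lambda>x. g (f x)) \<in> bimod_hom R S M P"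
  using assms by (auto simp: bimod_hom_def hom_def Pi_iff)

lemma hom_finprod:
  assumes "comm_group G" "comm_group H" "h \<in> hom G H" "f \<in> I \<rightarrow> carrier G"
  shows "h (finprod G f I) = finprod H (\<lambda>i. h (f i)) I"
proof -
  interpret G: comm_group G by fact
  interpret H: comm_group H by fact
  have one: "h \<one>\<^bsub>G\<^esub> = \<one>\<^bsub>H\<^esub>"
    using assms by (metis G.is_group H.is_group hom_one)
  show ?thesis
    using assms(4)
  proof (induction I rule: infinite_finite_induct)
    case (insert i I)
    then have "h (f i) \<in> carrier H" "(\<lambda>i. h (f i)) \<in> I \<rightarrow> carrier H"
      using assms(3) by (auto simp: hom_def)
    then show ?case
      using insert hom_mult[OF assms(3)] by simp
  qed (simp_all add: one)
qed

lemma hom_mult_fun: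
  assumes "comm_group G" "f \<in> hom M G" "g \<in> hom M G"
  shows "(\<lambda>x. f x \<otimes>\<^bsub>G\<^esub> g x) \<in> hom M G"
proof -
  interpret G: comm_group G by fact
  show ?thesis
    using assms(2,3) by (auto simp: hom_def Pi_iff G.m_ac)
qed

lemma hom_comp_fun:
  assumes "f \<in> hom M G" "g \<in> hom G H"
  shows "(\<lambda>x. g (f x)) \<in> hom M H"
  using assms by (auto simp: hom_def Pi_iff)

context bimodule
begin

lemma lact_zero: "r \<in> carrier R \<Longrightarrow> lact M r \<one>\<^bsub>M\<^esub> = \<one>\<^bsub>M\<^esub>"
  using lact_add_right[of r "\<one>\<^bsub>M\<^esub>" "\<one>\<^bsub>M\<^esub>"] lact_closed[of r "\<one>\<^bsub>M\<^esub>"] by simp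

lemma ract_zero: "s \<in> carrier S \<Longrightarrow> ract M \<one>\<^bsub>M\<^esub> s = \<one>\<^bsub>M\<^esub>"
  using ract_add_left[of s "\<one>\<^bsub>M\<^esub>" "\<one>\<^bsub>M\<^esub>"] ract_closed[of s "\<one>\<^bsub>M\<^esub>"] by simp

lemma lact_inv:
  assumes "r \<in> carrier R" "x \<in> carrier M"
  shows "lact M r (inv\<^bsub>M\<^esub> x) = inv\<^bsub>M\<^esub> (lact M r x)"
proof (rule M.inv_equality[symmetric])
  show "lact M r (inv\<^bsub>M\<^esub> x) \<otimes>\<^bsub>M\<^esub> lact M r x = \<one>\<^bsub>M\<^esub>"
    using assms by (simp add: lact_zero flip: lact_add_right)
qed (use assms lact_closed in auto)

lemma ract_inv:
  assumes "s \<in> carrier S" "x \<in> carrier M"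
  shows "ract M (inv\<^bsub>M\<^esub> x) s = inv\<^bsub>M\<^esub> (ract M x s)"
proof (rule M.inv_equality[symmetric])
  show "ract M (inv\<^bsub>M\<^esub> x) s \<otimes>\<^bsub>M\<^esub> ract M x s = \<one>\<^bsub>M\<^esub>"
    using assms by (simp add: ract_zero flip: ract_add_left)
qed (use assms ract_closed in auto)

end

text \<open>Serves to make the kernel of a bimodule map a bimodule; that kernel is the complement in
  \<open>bimod_divides_if_retract\<close>.\<close>

lemma bimoduleI_subset:
  fixes M :: "('r, 's, 'm) bimodule"
  assumes "bimodule R S M" "subgroup K M"
    and "\<And>r x. r \<in> carrier R \<Longrightarrow> x \<in> K \<Longrightarrow> lact M r x \<in> K"
    and "\<And>s x. s \<in> carrier S \<Longrightarrow> x \<in> K \<Longrightarrow> ract M x s \<in> K"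
  shows "bimodule R S (M\<lparr>carrier := K\<rparr>)"
proof -
  interpret bimodule R S M by fact
  have K: "\<And>x. x \<in> K \<Longrightarrow> x \<in> carrier M"
    using assms(2) by (rule subgroup.mem_carrier)
  have "comm_group (M\<lparr>carrier := K\<rparr>)"
    using K by (intro group.group_comm_groupI M.subgroup_imp_group assms(2)) (simp add: M.m_comm)
  then show ?thesis
    unfolding bimodule_def bimodule_axioms_def
    using assms(3,4) K R.ring_axioms S.ring_axioms
    by (simp add: lact_add_left lact_add_right ract_add_left ract_add_right
        lact_mult ract_mult lact_one ract_one lact_ract)
qed

text \<open>The record \<open>M\<close> does not contain its scalar rings, so restriction of scalars
  leaves it unchanged and only shrinks the range of the axioms.\<close>

lemma bimodule_restrict:
  fixes M :: "('r, 's, 'm) bimodule"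
  assumes "bimodule R S M" "ring R'" "ring S'"
    and "carrier R' \<subseteq> carrier R" "carrier S' \<subseteq> carrier S"
    and "monoid.mult R' = monoid.mult R" "add R' = add R" "\<one>\<^bsub>R'\<^esub> = \<one>\<^bsub>R\<^esub>"
    and "monoid.mult S' = monoid.mult S" "add S' = add S" "\<one>\<^bsub>S'\<^esub> = \<one>\<^bsub>S\<^esub>"
  shows "bimodule R' S' M"
proof -
  interpret bimodule R S M by fact
  show ?thesis
    unfolding bimodule_def bimodule_axioms_def
    using assms(2-) M.comm_group_axioms
    by (auto simp: lact_add_left lact_add_right ract_add_left ract_add_right
        lact_mult ract_mult lact_one ract_one lact_ract lact_closed ract_closed subset_iff)
qed

section \<open>Direct powers, retracts and divisibility\<close>

lemma copies_simps [simp]: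
  "carrier (copies k M) = ({..<k} \<rightarrow>\<^sub>E carrier M)"
  "monoid.mult (copies k M) = (\<lambda>x y. \<lambda>i\<in>{..<k}. x i \<otimes>\<^bsub>M\<^esub> y i)"
  "\<one>\<^bsub>copies k M\<^esub> = (\<lambda>i\<in>{..<k}. \<one>\<^bsub>M\<^esub>)"
  "lact (copies k M) = (\<lambda>r x. \<lambda>i\<in>{..<k}. lact M r (x i))"
  "ract (copies k M) = (\<lambda>x s. \<lambda>i\<in>{..<k}. ract M (x i) s)"
  by (simp_all add: copies_def Let_def)

lemma copies_eqI:
  assumes "x \<in> carrier (copies k M)" "y \<in> carrier (copies k M)" "\<And>i. i < k \<Longrightarrow> x i = y i"
  shows "x = y"
  using assms by (intro PiE_ext[of x "{..<k}" "\<lambda>_. carrier M"]) simp_all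

lemma bimodule_copies:
  assumes "bimodule R S M"
  shows "bimodule R S (copies k M)"
proof -
  interpret bimodule R S M by fact
  have group: "comm_group (copies k M)"
  proof (rule comm_groupI)
    fix x assume x: "x \<in> carrier (copies k M)"
    show "\<exists>y\<in>carrier (copies k M). y \<otimes>\<^bsub>copies k M\<^esub> x = \<one>\<^bsub>copies k M\<^esub>"
    proof
      show "(\<lambda>i\<in>{..<k}. inv\<^bsub>M\<^esub> (x i)) \<in> carrier (copies k M)"
        using x by (simp add: PiE_iff)
    qed (use x in \<open>simp add: PiE_iff cong: restrict_cong\<close>)
    show "\<one>\<^bsub>copies k M\<^esub> \<otimes>\<^bsub>copies k M\<^esub> x = x"
      by (rule copies_eqI[of _ k M]; use x in \<open>simp add: PiE_iff\<close>)
  qed (simp_all add: PiE_iff M.m_ac cong: restrict_cong)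
  have "bimodule_axioms R S (copies k M)"
  proof
    fix x assume x: "x \<in> carrier (copies k M)"
    show "lact (copies k M) \<one>\<^bsub>R\<^esub> x = x" "ract (copies k M) x \<one>\<^bsub>S\<^esub> = x"
      by (rule copies_eqI[of _ k M]; use x in \<open>simp add: PiE_iff lact_one ract_one\<close>)+
  qed (simp_all add: PiE_iff lact_add_left lact_add_right ract_add_left ract_add_right
      lact_mult ract_mult lact_ract lact_closed ract_closed cong: restrict_cong)
  then show ?thesis
    using group R.ring_axioms S.ring_axioms by (simp add: bimodule_def)
qed

text \<open>The idempotent endomorphism \<open>f\<close> after \<open>g\<close> splits
  \<open>N\<close>. The complement is the kernel of \<open>g\<close>, a subset of \<open>N\<close>,
  so it has the element type that \<open>bimod_divides\<close> asks for.\<close>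

lemma bimod_divides_if_retract:
  assumes "bimodule R S M" "bimodule R S N"
    and "f \<in> bimod_hom R S M N" "g \<in> bimod_hom R S N M"
    and "\<And>x. x \<in> carrier M \<Longrightarrow> g (f x) = x"
  shows "bimod_divides R S M N"
proof -
  interpret M: bimodule R S M by fact
  interpret N: bimodule R S N by fact
  note f = bimod_homD[OF assms(3)] and g = bimod_homD[OF assms(4)]
  interpret f: group_hom M N f by unfold_locales (rule f(1))
  interpret g: group_hom N M g by unfold_locales (rule g(1))
  define K where "K = kernel N M g"
  have K: "x \<in> K \<longleftrightarrow> x \<in> carrier N \<and> g x = \<one>\<^bsub>M\<^esub>" for x
    by (simp add: K_def kernel_def)
  have bimodK: "bimodule R S (N\<lparr>carrier := K\<rparr>)"
    using assms(2)
  proof (rule bimoduleI_subset)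
    show "subgroup K N"
      unfolding K_def by (rule g.subgroup_kernel)
  qed (auto simp: K N.lact_closed N.ract_closed g M.lact_zero M.ract_zero)
  \<comment> \<open>The splitting \<open>y = f (g y) + (y - f (g y))\<close>; the second summand
    lies in the kernel because \<open>g (f x) = x\<close>. The inverse is \<open>(u, v)\<close> to
    \<open>f u + v\<close>.\<close>
  define h where "h y = (g y, y \<otimes>\<^bsub>N\<^esub> inv\<^bsub>N\<^esub> (f (g y)))" for y
  let ?D = "direct_sum M (N\<lparr>carrier := K\<rparr>)"
  have "h \<in> iso N ?D"
  proof (rule isoI)
    show "h \<in> hom N ?D"
    proof (rule homI)
      fix x y assume xy: "x \<in> carrier N" "y \<in> carrier N"
      have "x \<otimes>\<^bsub>N\<^esub> y \<otimes>\<^bsub>N\<^esub> (inv\<^bsub>N\<^esub> f (g x) \<otimes>\<^bsub>N\<^esub> inv\<^bsub>N\<^esub> f (g y)) =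
          x \<otimes>\<^bsub>N\<^esub> inv\<^bsub>N\<^esub> f (g x) \<otimes>\<^bsub>N\<^esub> (y \<otimes>\<^bsub>N\<^esub> inv\<^bsub>N\<^esub> f (g y))"
        using xy by (simp add: N.m_ac)
      then show "h (x \<otimes>\<^bsub>N\<^esub> y) = h x \<otimes>\<^bsub>?D\<^esub> h y"
        using xy by (simp add: h_def direct_sum_def N.inv_mult)
    qed (simp add: h_def direct_sum_def K assms(5))
    show "bij_betw h (carrier N) (carrier ?D)"
    proof (rule bij_betwI[where g = "\<lambda>(x, y). f x \<otimes>\<^bsub>N\<^esub> y"])
      show "h \<in> carrier N \<rightarrow> carrier ?D"
        by (simp add: h_def direct_sum_def K assms(5))
      show "(\<lambda>(x, y). f x \<otimes>\<^bsub>N\<^esub> y) \<in> carrier ?D \<rightarrow> carrier N"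
        by (auto simp: direct_sum_def K)
      show "(case h x of (x, y) \<Rightarrow> f x \<otimes>\<^bsub>N\<^esub> y) = x" if "x \<in> carrier N" for x
        using that by (simp add: h_def N.m_lcomm[of "f (g x)"])
      show "h (case y of (x, y) \<Rightarrow> f x \<otimes>\<^bsub>N\<^esub> y) = y" if "y \<in> carrier ?D" for y
      proof -
        obtain u v where y: "y = (u, v)" by force
        have uv: "u \<in> carrier M" "v \<in> carrier N" "g v = \<one>\<^bsub>M\<^esub>"
          using that by (auto simp: y direct_sum_def K)
        then have "f u \<otimes>\<^bsub>N\<^esub> v \<otimes>\<^bsub>N\<^esub> inv\<^bsub>N\<^esub> f u = v"
          by (simp add: N.m_comm[of "f u" v] N.m_assoc)
        then show ?thesis
          using uv by (simp add: y h_def assms(5))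
      qed
    qed
  qed
  moreover have "h (lact N r x) = lact ?D r (h x)" if "r \<in> carrier R" "x \<in> carrier N" for r x
    using that f g by (simp add: h_def direct_sum_def N.lact_inv N.lact_add_right N.lact_closed)
  moreover have "h (ract N x s) = ract ?D (h x) s" if "s \<in> carrier S" "x \<in> carrier N" for s x
    using that f g by (simp add: h_def direct_sum_def N.ract_inv N.ract_add_left N.ract_closed)
  ultimately show ?thesis
    unfolding bimod_divides_def bimod_isomorphic_def using bimodK by blast
qed

lemma retract_if_bimod_divides:
  fixes M :: "('r, 's, 'm) bimodule" and N :: "('r, 's, 'n) bimodule"
  assumes "bimod_divides R S M N" "bimodule R S M" "bimodule R S N"
  obtains f g where "f \<in> bimod_hom R S M N" "g \<in> bimod_hom R S N M"
    "\<And>x. x \<in> carrier M \<Longrightarrow> g (f x) = x"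
proof -
  obtain M' :: "('r, 's, 'n) bimodule" and h where M': "bimodule R S M'" and h: "h \<in> iso N (direct_sum M M')"
    and lin: "\<And>x r. x \<in> carrier N \<Longrightarrow> r \<in> carrier R \<Longrightarrow>
        h (lact N r x) = lact (direct_sum M M') r (h x)"
      "\<And>x s. x \<in> carrier N \<Longrightarrow> s \<in> carrier S \<Longrightarrow>
        h (ract N x s) = ract (direct_sum M M') (h x) s"
    using assms(1) unfolding bimod_divides_def bimod_isomorphic_def by blast
  interpret M: bimodule R S M by fact
  interpret N: bimodule R S N by fact
  interpret M': bimodule R S M' by fact
  have hom: "h \<in> hom N (direct_sum M M')" and bij: "bij_betw h (carrier N) (carrier (direct_sum M M'))"
    using h by (auto simp: iso_def)
  have g: "(\<lambda>x. fst (h x)) \<in> bimod_hom R S N M"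
    using hom by (intro bimod_homI)
      (auto simp: hom_def direct_sum_def lin Pi_iff split_beta mem_Times_iff DirProd_def)
  \<comment> \<open>The inclusion of the summand \<open>M\<close>, transported back along the
    isomorphism \<open>h\<close>; the retraction is the first coordinate of
    \<open>h\<close>.\<close>
  define f where "f x = inv_into (carrier N) h (x, \<one>\<^bsub>M'\<^esub>)" for x
  have f_in: "f x \<in> carrier N" and hf: "h (f x) = (x, \<one>\<^bsub>M'\<^esub>)" if "x \<in> carrier M" for x
  proof -
    have "(x, \<one>\<^bsub>M'\<^esub>) \<in> h ` carrier N"
      using bij that by (simp add: bij_betw_def direct_sum_def)
    then show "f x \<in> carrier N" "h (f x) = (x, \<one>\<^bsub>M'\<^esub>)"
      by (simp_all add: f_def inv_into_into f_inv_into_f)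
  qed
  \<comment> \<open>By injectivity of \<open>h\<close>, linearity of \<open>f\<close> may be checked
    after applying \<open>h\<close>, where it is visible in coordinates.\<close>
  have eqI: "x = y" if "x \<in> carrier N" "y \<in> carrier N" "h x = h y" for x y
    using bij that by (meson bij_betw_def inj_on_def)
  have "f \<in> bimod_hom R S M N"
  proof (rule bimod_homI)
    show "f \<in> hom M N"
    proof (rule homI)
      fix x y assume xy: "x \<in> carrier M" "y \<in> carrier M"
      then have "h (f x \<otimes>\<^bsub>N\<^esub> f y) = (x \<otimes>\<^bsub>M\<^esub> y, \<one>\<^bsub>M'\<^esub>)"
        using f_in hf hom_mult[OF hom] by (simp add: direct_sum_def)
      then show "f (x \<otimes>\<^bsub>M\<^esub> y) = f x \<otimes>\<^bsub>N\<^esub> f y"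
        using xy f_in hf by (intro eqI) auto
    qed (rule f_in)
    show "f (lact M r x) = lact N r (f x)" if "r \<in> carrier R" "x \<in> carrier M" for r x
      using that f_in hf by (intro eqI) (auto simp: lin direct_sum_def M'.lact_zero N.lact_closed M.lact_closed)
    show "f (ract M x s) = ract N (f x) s" if "s \<in> carrier S" "x \<in> carrier M" for s x
      using that f_in hf by (intro eqI) (auto simp: lin direct_sum_def M'.ract_zero N.ract_closed M.ract_closed)
  qed
  then show thesis
    using g hf by (intro that) auto
qed

text \<open>A map into \<open>copies k N\<close> is a family of \<open>k\<close> maps into
  \<open>N\<close>, and a map out of it is the sum of its restrictions to the \<open>k\<close>
  coordinates. A retraction through the power thus amounts to \<open>k\<close> pairs of
  maps.\<close>

lemma bimod_divides_copies_iff: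
  assumes "bimodule R S M" "bimodule R S N"
  shows "bimod_divides R S M (copies k N) \<longleftrightarrow>
    (\<exists>f g. (\<forall>i<k. f i \<in> bimod_hom R S M N \<and> g i \<in> bimod_hom R S N M) \<and>
      (\<forall>x\<in>carrier M. finprod M (\<lambda>i. g i (f i x)) {..<k} = x))"
    (is "?L \<longleftrightarrow> ?R")
proof -
  interpret M: bimodule R S M by fact
  interpret N: bimodule R S N by fact
  interpret C: bimodule R S "copies k N"
    by (rule bimodule_copies) fact
  show ?thesis
  proof
    assume ?L
    then obtain f g where f: "f \<in> bimod_hom R S M (copies k N)"
      and g: "g \<in> bimod_hom R S (copies k N) M"
      and gf: "\<And>x. x \<in> carrier M \<Longrightarrow> g (f x) = x"
      by (rule retract_if_bimod_divides[OF _ assms(1) C.bimodule_axioms]) (rule that)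
    \<comment> \<open>The inclusion of \<open>N\<close> as coordinate \<open>i\<close> of the
      power.\<close>
    define e where "e i x = (\<lambda>j\<in>{..<k}. if j = i then x else \<one>\<^bsub>N\<^esub>)" for i x
    have e: "e i \<in> bimod_hom R S N (copies k N)" if "i < k" for i
      by (rule bimod_homI)
        (auto simp: e_def hom_def Pi_iff PiE_iff N.lact_zero N.ract_zero intro!: restrict_ext)
    have pr: "(\<lambda>x. x i) \<in> bimod_hom R S (copies k N) N" if "i < k" for i
      using that by (simp add: bimod_hom_def hom_def Pi_iff PiE_iff)
    \<comment> \<open>The identity of the power is the sum of the coordinate projections followed by
      the coordinate inclusions. Inserting it between \<open>f\<close> and \<open>g\<close>
      decomposes the identity of \<open>M\<close>.\<close>
    have sum_e: "finprod (copies k N) (\<lambda>i. e i (y i)) {..<k} = y" if y: "y \<in> carrier (copies k N)" for y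
    proof
      fix j
      have Pi: "(\<lambda>i. e i (y i)) \<in> {..<k} \<rightarrow> carrier (copies k N)"
        using y by (simp add: e_def Pi_iff PiE_iff)
      then have mem: "finprod (copies k N) (\<lambda>i. e i (y i)) {..<k} \<in> carrier (copies k N)"
        by (rule C.finprod_closed)
      show "finprod (copies k N) (\<lambda>i. e i (y i)) {..<k} j = y j"
      proof (cases "j < k")
        case True
        then have "finprod (copies k N) (\<lambda>i. e i (y i)) {..<k} j
            = finprod N (\<lambda>i. e i (y i) j) {..<k}"
          using hom_finprod[OF C.comm_group_axioms N.comm_group_axioms bimod_hom_hom[OF pr[OF True]] Pi]
          by simp
        also have "\<dots> = finprod N (\<lambda>i. if j = i then y i else \<one>\<^bsub>N\<^esub>) {..<k}"
          using True y by (intro N.finprod_cong') (simp_all add: e_def PiE_iff Pi_iff)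
        also have "\<dots> = y j"
          using True y by (intro N.finprod_singleton) (simp_all add: PiE_iff Pi_iff)
        finally show ?thesis .
      next
        \<comment> \<open>Elements of the power are extensional, so both sides are
          \<open>undefined\<close> outside \<open>{..<k}\<close>.\<close>
        case False
        then show ?thesis
          using y mem by (simp add: PiE_iff extensional_def)
      qed
    qed
    have "finprod M (\<lambda>i. g (e i (f x i))) {..<k} = x" if x: "x \<in> carrier M" for x
    proof -
      have fx: "f x \<in> carrier (copies k N)"
        using f x by (rule bimod_hom_closed)
      then have Pi: "(\<lambda>i. e i (f x i)) \<in> {..<k} \<rightarrow> carrier (copies k N)"
        by (simp add: e_def Pi_iff PiE_iff)
      have "finprod M (\<lambda>i. g (e i (f x i))) {..<k} = g (finprod (copies k N) (\<lambda>i. e i (f x i)) {..<k})"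
        using hom_finprod[OF C.comm_group_axioms M.comm_group_axioms bimod_hom_hom[OF g] Pi] by simp
      then show ?thesis
        using sum_e[OF fx] gf x by simp
    qed
    moreover have "(\<lambda>x. f x i) \<in> bimod_hom R S M N" "(\<lambda>x. g (e i x)) \<in> bimod_hom R S N M" if "i < k" for i
      using bimod_hom_comp[OF f pr[OF that]] bimod_hom_comp[OF e[OF that] g] .
    ultimately show ?R
      by (intro exI[of _ "\<lambda>i x. f x i"] exI[of _ "\<lambda>i x. g (e i x)"]) simp
  next
    assume ?R
    then obtain f g where f: "\<And>i. i < k \<Longrightarrow> f i \<in> bimod_hom R S M N"
      and g: "\<And>i. i < k \<Longrightarrow> g i \<in> bimod_hom R S N M"
      and gf: "\<And>x. x \<in> carrier M \<Longrightarrow> finprod M (\<lambda>i. g i (f i x)) {..<k} = x"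
      by blast
    show ?L
    proof (rule bimod_divides_if_retract)
      show "bimodule R S M" "bimodule R S (copies k N)" by unfold_locales
      \<comment> \<open>The families are reassembled: all \<open>f i\<close> in parallel into the
        power, and the sum of the \<open>g i\<close> out of it.\<close>
      show "(\<lambda>x. \<lambda>i\<in>{..<k}. f i x) \<in> bimod_hom R S M (copies k N)"
        using bimod_homD[OF f] by (intro bimod_homI homI) (simp_all add: PiE_iff cong: restrict_cong)
      show "(\<lambda>y. finprod M (\<lambda>i. g i (y i)) {..<k}) \<in> bimod_hom R S (copies k N) M"
      proof (intro bimod_homI homI)
        fix x y assume xy: "x \<in> carrier (copies k N)" "y \<in> carrier (copies k N)"
        then have "finprod M (\<lambda>i. g i ((x \<otimes>\<^bsub>copies k N\<^esub> y) i)) {..<k} =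
            finprod M (\<lambda>i. g i (x i) \<otimes>\<^bsub>M\<^esub> g i (y i)) {..<k}"
          by (intro M.finprod_cong') (simp_all add: PiE_iff Pi_iff bimod_homD[OF g])
        also have "\<dots> = finprod M (\<lambda>i. g i (x i)) {..<k} \<otimes>\<^bsub>M\<^esub> finprod M (\<lambda>i. g i (y i)) {..<k}"
          using xy by (intro M.finprod_multf) (simp_all add: PiE_iff Pi_iff bimod_homD[OF g])
        finally show "finprod M (\<lambda>i. g i ((x \<otimes>\<^bsub>copies k N\<^esub> y) i)) {..<k} =
          finprod M (\<lambda>i. g i (x i)) {..<k} \<otimes>\<^bsub>M\<^esub> finprod M (\<lambda>i. g i (y i)) {..<k}" .
      next
        fix r x assume r: "r \<in> carrier R" and x: "x \<in> carrier (copies k N)"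
        have hom: "lact M r \<in> hom M M"
          using r by (auto simp: hom_def M.lact_closed M.lact_add_right)
        have "finprod M (\<lambda>i. g i (lact (copies k N) r x i)) {..<k} =
            finprod M (\<lambda>i. lact M r (g i (x i))) {..<k}"
          using r x by (intro M.finprod_cong') (simp_all add: PiE_iff Pi_iff bimod_homD[OF g] M.lact_closed)
        also have "\<dots> = lact M r (finprod M (\<lambda>i. g i (x i)) {..<k})"
          using x by (intro hom_finprod[symmetric, where h = "lact M r"] hom M.comm_group_axioms)
            (simp_all add: PiE_iff Pi_iff bimod_homD[OF g])
        finally show "finprod M (\<lambda>i. g i (lact (copies k N) r x i)) {..<k} =
          lact M r (finprod M (\<lambda>i. g i (x i)) {..<k})" .
      next
        fix s x assume s: "s \<in> carrier S" and x: "x \<in> carrier (copies k N)"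
        have hom: "(\<lambda>m. ract M m s) \<in> hom M M"
          using s by (auto simp: hom_def M.ract_closed M.ract_add_left)
        have "finprod M (\<lambda>i. g i (ract (copies k N) x s i)) {..<k} =
            finprod M (\<lambda>i. ract M (g i (x i)) s) {..<k}"
          using s x by (intro M.finprod_cong') (simp_all add: PiE_iff Pi_iff bimod_homD[OF g] M.ract_closed)
        also have "\<dots> = ract M (finprod M (\<lambda>i. g i (x i)) {..<k}) s"
          using x by (intro hom_finprod[symmetric, where h = "\<lambda>m. ract M m s"] hom M.comm_group_axioms)
            (simp_all add: PiE_iff Pi_iff bimod_homD[OF g])
        finally show "finprod M (\<lambda>i. g i (ract (copies k N) x s i)) {..<k} =
          ract M (finprod M (\<lambda>i. g i (x i)) {..<k}) s" .
      qed (simp add: PiE_iff Pi_iff bimod_homD[OF g])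
      fix x assume x: "x \<in> carrier M"
      have "finprod M (\<lambda>i. g i ((\<lambda>i\<in>{..<k}. f i x) i)) {..<k} = finprod M (\<lambda>i. g i (f i x)) {..<k}"
        using x by (intro M.finprod_cong') (simp_all add: Pi_iff bimod_homD[OF f] bimod_homD[OF g])
      then show "finprod M (\<lambda>i. g i ((\<lambda>i\<in>{..<k}. f i x) i)) {..<k} = x"
        using gf[OF x] by simp
    qed
  qed
qed

lemma bimod_divides_copiesE:
  assumes "bimod_divides R S M (copies k N)" "bimodule R S M" "bimodule R S N"
  obtains f g where "\<And>i. i < k \<Longrightarrow> f i \<in> bimod_hom R S M N" "\<And>i. i < k \<Longrightarrow> g i \<in> bimod_hom R S N M"
    "\<And>x. x \<in> carrier M \<Longrightarrow> finprod M (\<lambda>i. g i (f i x)) {..<k} = x"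
proof -
  obtain f g where fg: "\<forall>i<k. f i \<in> bimod_hom R S M N \<and> g i \<in> bimod_hom R S N M"
    "\<forall>x\<in>carrier M. finprod M (\<lambda>i. g i (f i x)) {..<k} = x"
    using assms(1) unfolding bimod_divides_copies_iff[OF assms(2,3)] by (elim exE conjE)
  show thesis
    by (rule that[of f g]) (simp_all add: fg)
qed


section \<open>Tensor powers\<close>

lemma keys_frag_extend_subset:
  assumes "Poly_Mapping.keys x \<subseteq> S" "\<And>as. as \<in> S \<Longrightarrow> g as \<in> T"
  shows "Poly_Mapping.keys (frag_extend (\<lambda>as. frag_of (g as)) x) \<subseteq> T"
  using keys_frag_extend[of "\<lambda>as. frag_of (g as)" x] assms by auto

locale ring_extension = ring A for A :: "('a, 'c) ring_scheme" (structure) +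
  fixes B :: "'a set"
  assumes subring: "subring B A"
begin

lemma subset: "b \<in> B \<Longrightarrow> b \<in> carrier A"
  using subring by (auto dest: subringE(1))

abbreviation relations :: "nat \<Rightarrow> ('a list \<Rightarrow>\<^sub>0 int) set"
  where "relations m \<equiv> generate (tuples_group A m) (tensor_relators A B m)"

definition tensor :: "'a list \<Rightarrow> ('a list \<Rightarrow>\<^sub>0 int) set"
  where "tensor as = relations (length as) #>\<^bsub>tuples_group A (length as)\<^esub> frag_of as"

lemma comm_group_tuples: "comm_group (tuples_group A m)"
  unfolding tuples_group_def by (rule abelian_free_Abelian_group)

lemma tuples_group_simps [simp]:
  "x \<in> carrier (tuples_group A m) \<longleftrightarrow>
    Poly_Mapping.keys x \<subseteq> {as \<in> lists (carrier A). length as = m}"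
  "x \<otimes>\<^bsub>tuples_group A m\<^esub> y = x + y"
  "\<one>\<^bsub>tuples_group A m\<^esub> = 0"
  by (simp_all add: tuples_group_def)

lemma inv_tuples_group [simp]:
  "x \<in> carrier (tuples_group A m) \<Longrightarrow> inv\<^bsub>tuples_group A m\<^esub> x = - x"
  by (simp add: tuples_group_def)

lemma tensor_relators_closed: "tensor_relators A B m \<subseteq> carrier (tuples_group A m)"
proof
  fix t assume "t \<in> tensor_relators A B m"
  then show "t \<in> carrier (tuples_group A m)"
    unfolding tensor_relators_def tuples_group_simps
    by (auto dest!: subsetD[OF keys_diff] simp: subset)
qed

lemma subgroup_relations: "subgroup (relations m) (tuples_group A m)"
  using comm_group_tuples[of m]
  by (simp add: comm_group_def group.generate_is_subgroup tensor_relators_closed)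

lemma relations_closed: "x \<in> relations m \<Longrightarrow> x \<in> carrier (tuples_group A m)"
  using subgroup_relations by (rule subgroup.mem_carrier)

lemma relations_add: "x \<in> relations m \<Longrightarrow> y \<in> relations m \<Longrightarrow> x + y \<in> relations m"
  using subgroup.m_closed[OF subgroup_relations] by simp

lemma relations_uminus: "x \<in> relations m \<Longrightarrow> - x \<in> relations m"
  using subgroup.m_inv_closed[OF subgroup_relations] relations_closed by (metis inv_tuples_group)

lemma relations_zero: "0 \<in> relations m"
  using subgroup.one_closed[OF subgroup_relations] by simp

lemma normal_relations: "relations m \<lhd> tuples_group A m"
  by (intro comm_group.subgroup_imp_normal comm_group_tuples subgroup_relations)

lemma coset_eq_image: "relations m #>\<^bsub>tuples_group A m\<^esub> x = (\<lambda>n. n + x) ` relations m"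
  by (auto simp: r_coset_def)

lemma coset_eqI:
  assumes "x - y \<in> relations m"
  shows "relations m #>\<^bsub>tuples_group A m\<^esub> x = relations m #>\<^bsub>tuples_group A m\<^esub> y"
proof -
  have sub: "relations m #>\<^bsub>tuples_group A m\<^esub> x \<subseteq> relations m #>\<^bsub>tuples_group A m\<^esub> y"
    if "x - y \<in> relations m" for x y
  proof
    fix z assume "z \<in> relations m #>\<^bsub>tuples_group A m\<^esub> x"
    then obtain h where h: "h \<in> relations m" "z = h + x"
      unfolding coset_eq_image by blast
    then have "z = (h + (x - y)) + y" by simp
    moreover have "h + (x - y) \<in> relations m"
      using h(1) that by (rule relations_add)
    ultimately show "z \<in> relations m #>\<^bsub>tuples_group A m\<^esub> y"
      unfolding coset_eq_image by (rule image_eqI)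
  qed
  have "y - x \<in> relations m"
    using relations_uminus[OF assms] by simp
  then show ?thesis
    using sub assms by blast
qed

lemma tensor_power_simps:
  "carrier (tensor_power A B m) = carrier (tuples_group A m Mod relations m)"
  "monoid.mult (tensor_power A B m) = monoid.mult (tuples_group A m Mod relations m)"
  "\<one>\<^bsub>tensor_power A B m\<^esub> = \<one>\<^bsub>tuples_group A m Mod relations m\<^esub>"
  by (simp_all add: tensor_power_def Let_def)

lemma hom_tensor_power:
  "hom (tensor_power A B m) G = hom (tuples_group A m Mod relations m) G"
  "hom G (tensor_power A B m) = hom G (tuples_group A m Mod relations m)"
  by (simp_all add: hom_def tensor_power_simps)

lemma comm_group_tensor_power: "comm_group (tensor_power A B m)"
proof -
  \<comment> \<open>The record of the tensor power has two action fields more than the quotient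
    group and is not literally that group, so the axioms are carried over one by one.\<close>
  interpret Q: comm_group "tuples_group A m Mod relations m"
    by (intro comm_group.abelian_FactGroup comm_group_tuples subgroup_relations)
  show ?thesis
    by (rule comm_groupI; unfold tensor_power_simps)
      (assumption | rule Q.m_assoc Q.m_comm Q.l_inv_ex Q.l_one Q.m_closed Q.one_closed)+
qed

lemma coset_hom:
  "(\<lambda>x. relations m #>\<^bsub>tuples_group A m\<^esub> x) \<in> hom (tuples_group A m) (tensor_power A B m)"
  unfolding hom_tensor_power using normal_relations by (rule normal.r_coset_hom_Mod)

lemma tensor_closed:
  "as \<in> lists (carrier A) \<Longrightarrow> length as = m \<Longrightarrow> tensor as \<in> carrier (tensor_power A B m)"
  using hom_in_carrier[OF coset_hom, of "frag_of as" m] by (simp add: tensor_def)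

lemma coset_add:
  assumes "x \<in> carrier (tuples_group A m)" "y \<in> carrier (tuples_group A m)"
  shows "relations m #>\<^bsub>tuples_group A m\<^esub> (x + y) =
    (relations m #>\<^bsub>tuples_group A m\<^esub> x) \<otimes>\<^bsub>tensor_power A B m\<^esub> (relations m #>\<^bsub>tuples_group A m\<^esub> y)"
  using hom_mult[OF coset_hom assms] by (simp only: tuples_group_simps)

lemma additivity_relation:
  assumes "us \<in> lists (carrier A)" "vs \<in> lists (carrier A)" "x \<in> carrier A" "y \<in> carrier A"
    and "length us + 1 + length vs = m"
  shows "frag_of (us @ (x \<oplus> y) # vs) - frag_of (us @ x # vs) - frag_of (us @ y # vs) \<in> relations m"
  unfolding tensor_relators_def using assms by (intro generate.incl UnI1) blast

lemma balancing_relation: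
  assumes "us \<in> lists (carrier A)" "vs \<in> lists (carrier A)" "x \<in> carrier A" "y \<in> carrier A" "b \<in> B"
    and "length us + 2 + length vs = m"
  shows "frag_of (us @ (x \<otimes> b) # y # vs) - frag_of (us @ x # (b \<otimes> y) # vs) \<in> relations m"
  unfolding tensor_relators_def using assms by (intro generate.incl UnI2) blast

lemma tensor_relators_cases:
  assumes "t \<in> tensor_relators A B m"
  obtains
    (add) us x y and vs :: "'a list" where
      "t = frag_of (us @ (x \<oplus> y) # vs) - frag_of (us @ x # vs) - frag_of (us @ y # vs)"
      "us \<in> lists (carrier A)" "vs \<in> lists (carrier A)" "x \<in> carrier A" "y \<in> carrier A"
      "length us + 1 + length vs = m"
  | (balance) us x b y and vs :: "'a list" where
      "t = frag_of (us @ (x \<otimes> b) # y # vs) - frag_of (us @ x # (b \<otimes> y) # vs)"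
      "us \<in> lists (carrier A)" "vs \<in> lists (carrier A)" "x \<in> carrier A" "y \<in> carrier A" "b \<in> B"
      "length us + 2 + length vs = m"
  using assms unfolding tensor_relators_def by blast

lemma tensor_add:
  assumes "us \<in> lists (carrier A)" "vs \<in> lists (carrier A)" "x \<in> carrier A" "y \<in> carrier A"
    and m: "length us + 1 + length vs = m"
  shows "tensor (us @ (x \<oplus> y) # vs) = tensor (us @ x # vs) \<otimes>\<^bsub>tensor_power A B m\<^esub> tensor (us @ y # vs)"
proof -
  note additivity_relation[OF assms]
  then have "tensor (us @ (x \<oplus> y) # vs) =
      relations m #>\<^bsub>tuples_group A m\<^esub> (frag_of (us @ x # vs) + frag_of (us @ y # vs))"
    unfolding tensor_def using m by (simp add: coset_eqI diff_diff_eq del: tuples_group_simps)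
  moreover have "frag_of (us @ x # vs) \<in> carrier (tuples_group A m)"
    "frag_of (us @ y # vs) \<in> carrier (tuples_group A m)"
    using assms by simp_all
  moreover have "length (us @ x # vs) = m" "length (us @ y # vs) = m"
    using m by simp_all
  ultimately show ?thesis
    unfolding tensor_def by (simp only: coset_add)
qed

lemma tensor_balanced:
  assumes "us \<in> lists (carrier A)" "vs \<in> lists (carrier A)" "x \<in> carrier A" "y \<in> carrier A" "b \<in> B"
  shows "tensor (us @ (x \<otimes> b) # y # vs) = tensor (us @ x # (b \<otimes> y) # vs)"
proof -
  note balancing_relation[OF assms refl]
  then show ?thesis
    unfolding tensor_def by (simp add: coset_eqI)
qed

lemma tensor_power_coset_cases:
  assumes "U \<in> carrier (tensor_power A B m)"
  obtains x where "x \<in> carrier (tuples_group A m)" "U = relations m #>\<^bsub>tuples_group A m\<^esub> x"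
  using assms by (auto simp: tensor_power_simps carrier_FactGroup)

section \<open>Universal property and generation by pure tensors\<close>

text \<open>\<open>f\<close> extends to the free abelian group on tuples. Additivity and
  balancedness put the relators into the kernel, hence also the subgroup they generate, and the
  extension descends to the quotient. Only a group homomorphism results; compatibility with the
  actions is treated separately.\<close>

lemma tensor_power_hom_exists:
  assumes G: "comm_group G"
    and closed: "\<And>as. as \<in> lists (carrier A) \<Longrightarrow> length as = m \<Longrightarrow> f as \<in> carrier G"
    and add: "\<And>us vs x y. \<lbrakk>us \<in> lists (carrier A); vs \<in> lists (carrier A); x \<in> carrier A; y \<in> carrier A;
        length us + 1 + length vs = m\<rbrakk>
      \<Longrightarrow> f (us @ (x \<oplus> y) # vs) = f (us @ x # vs) \<otimes>\<^bsub>G\<^esub> f (us @ y # vs)"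
    and balanced: "\<And>us vs x y b. \<lbrakk>us \<in> lists (carrier A); vs \<in> lists (carrier A); x \<in> carrier A;
        y \<in> carrier A; b \<in> B; length us + 2 + length vs = m\<rbrakk>
      \<Longrightarrow> f (us @ (x \<otimes> b) # y # vs) = f (us @ x # (b \<otimes> y) # vs)"
  obtains h where "h \<in> hom (tensor_power A B m) G"
    "\<And>as. as \<in> lists (carrier A) \<Longrightarrow> length as = m \<Longrightarrow> h (tensor as) = f as"
proof -
  interpret G: comm_group G by fact
  let ?S = "{as \<in> lists (carrier A). length as = m}"
  interpret F: comm_group "tuples_group A m" by (rule comm_group_tuples)
  obtain g where g: "g \<in> hom (tuples_group A m) G" and g_of: "\<And>as. as \<in> ?S \<Longrightarrow> g (frag_of as) = f as"
    unfolding tuples_group_def using G.free_Abelian_group_universal[of f ?S] closed by auto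
  interpret g: group_hom "tuples_group A m" G g
    by unfold_locales (rule g)
  have g_diff: "g (x - y) = g x \<otimes>\<^bsub>G\<^esub> inv\<^bsub>G\<^esub> (g y)"
    if "x \<in> carrier (tuples_group A m)" "y \<in> carrier (tuples_group A m)" for x y
    using g.hom_mult[of x "- y"] g.hom_inv[of y] that by simp
  have diff_closed: "x - y \<in> carrier (tuples_group A m)"
    if "x \<in> carrier (tuples_group A m)" "y \<in> carrier (tuples_group A m)" for x y
    using that by (simp only: tuples_group_simps) (rule order_trans[OF keys_diff Un_least])
  have "relations m \<subseteq> kernel (tuples_group A m) G g"
  proof (rule F.generate_subgroup_incl)
    show "subgroup (kernel (tuples_group A m) G g) (tuples_group A m)"
      by (rule g.subgroup_kernel)
    show "tensor_relators A B m \<subseteq> kernel (tuples_group A m) G g"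
    proof
      fix t assume "t \<in> tensor_relators A B m"
      then show "t \<in> kernel (tuples_group A m) G g"
      proof (cases rule: tensor_relators_cases)
        case (add us x y vs)
        then have S: "us @ (x \<oplus> y) # vs \<in> ?S" "us @ x # vs \<in> ?S" "us @ y # vs \<in> ?S"
          by auto
        then have c: "frag_of (us @ (x \<oplus> y) # vs) \<in> carrier (tuples_group A m)"
          "frag_of (us @ x # vs) \<in> carrier (tuples_group A m)"
          "frag_of (us @ y # vs) \<in> carrier (tuples_group A m)"
          by simp_all
        have fc: "f (us @ x # vs) \<in> carrier G" "f (us @ y # vs) \<in> carrier G"
          using S closed by auto
        then have "g t = \<one>\<^bsub>G\<^esub>"
          using assms(3)[OF add(2-6)] unfolding add(1)
          by (simp only: g_diff diff_closed c g_of[OF S(1)] g_of[OF S(2)] g_of[OF S(3)])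
            (simp add: G.m_comm[of "f (us @ x # vs)"] G.m_assoc)
        moreover have "t \<in> carrier (tuples_group A m)"
          unfolding add(1) by (intro diff_closed c)
        ultimately show ?thesis by (simp only: kernel_def mem_Collect_eq)
      next
        case (balance us x b y vs)
        then have S: "us @ (x \<otimes> b) # y # vs \<in> ?S" "us @ x # (b \<otimes> y) # vs \<in> ?S"
          by (auto simp: subset)
        then have c: "frag_of (us @ (x \<otimes> b) # y # vs) \<in> carrier (tuples_group A m)"
          "frag_of (us @ x # (b \<otimes> y) # vs) \<in> carrier (tuples_group A m)"
          by simp_all
        have fc: "f (us @ x # (b \<otimes> y) # vs) \<in> carrier G"
          using S closed by auto
        then have "g t = \<one>\<^bsub>G\<^esub>"
          using balanced[OF balance(2-7)] unfolding balance(1)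
          by (simp only: g_diff c g_of[OF S(1)] g_of[OF S(2)] G.r_inv)
        moreover have "t \<in> carrier (tuples_group A m)"
          unfolding balance(1) by (intro diff_closed c)
        ultimately show ?thesis by (simp only: kernel_def mem_Collect_eq)
      qed
    qed
  qed
  then obtain h where h: "h \<in> hom (tuples_group A m Mod relations m) G"
    "\<And>x. x \<in> carrier (tuples_group A m) \<Longrightarrow> h (relations m #>\<^bsub>tuples_group A m\<^esub> x) = g x"
    using g.FactGroup_universal_kernel[OF normal_relations] by blast
  show thesis
  proof
    show "h \<in> hom (tensor_power A B m) G" using h(1) by (simp add: hom_tensor_power)
    show "h (tensor as) = f as" if "as \<in> lists (carrier A)" "length as = m" for as
      using h(2)[of "frag_of as"] that g_of[of as] by (simp add: tensor_def)
  qed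
qed

lemma tensor_zero:
  assumes "us \<in> lists (carrier A)" "vs \<in> lists (carrier A)" "length us + 1 + length vs = m"
  shows "tensor (us @ \<zero> # vs) = \<one>\<^bsub>tensor_power A B m\<^esub>"
proof -
  interpret T: comm_group "tensor_power A B m" by (rule comm_group_tensor_power)
  have "tensor (us @ \<zero> # vs) \<in> carrier (tensor_power A B m)"
    using assms by (intro tensor_closed) auto
  moreover have "tensor (us @ \<zero> # vs) = tensor (us @ \<zero> # vs) \<otimes>\<^bsub>tensor_power A B m\<^esub> tensor (us @ \<zero> # vs)"
    using tensor_add[OF assms(1,2) zero_closed zero_closed assms(3)] by simp
  ultimately show ?thesis by simp
qed

text \<open>The negative of a pure tensor is again a pure tensor. This is why the induction rule
  below can do without a case for inverses.\<close>

lemma tensor_uminus: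
  assumes "us \<in> lists (carrier A)" "vs \<in> lists (carrier A)" "x \<in> carrier A"
    and "length us + 1 + length vs = m"
  shows "tensor (us @ (\<ominus> x) # vs) = inv\<^bsub>tensor_power A B m\<^esub> (tensor (us @ x # vs))"
proof -
  interpret T: comm_group "tensor_power A B m" by (rule comm_group_tensor_power)
  have "tensor (us @ (\<ominus> x) # vs) \<otimes>\<^bsub>tensor_power A B m\<^esub> tensor (us @ x # vs) = \<one>\<^bsub>tensor_power A B m\<^esub>"
    using tensor_add[OF assms(1,2) a_inv_closed[OF assms(3)] assms(3,4)] assms tensor_zero[OF assms(1,2,4)]
    by (simp add: l_neg)
  then show ?thesis
    using assms by (intro T.inv_equality[symmetric] tensor_closed) auto
qed

text \<open>Every class is an integer combination of pure tensors. Since \<open>m\<close> is at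
  least 1, zero and negatives of pure tensors are themselves pure, so closure under sums is
  enough.\<close>

lemma tensor_power_induct [consumes 2, case_names add tensor]:
  assumes U: "U \<in> carrier (tensor_power A B m)" and m: "m \<ge> 1"
    and add: "\<And>x y. \<lbrakk>x \<in> carrier (tensor_power A B m); y \<in> carrier (tensor_power A B m); P x; P y\<rbrakk>
        \<Longrightarrow> P (x \<otimes>\<^bsub>tensor_power A B m\<^esub> y)"
    and tensor: "\<And>as. \<lbrakk>as \<in> lists (carrier A); length as = m\<rbrakk> \<Longrightarrow> P (tensor as)"
  shows "P U"
proof -
  interpret T: comm_group "tensor_power A B m" by (rule comm_group_tensor_power)
  let ?c = "\<lambda>x. relations m #>\<^bsub>tuples_group A m\<^esub> x"
  interpret c: group_hom "tuples_group A m" "tensor_power A B m" ?c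
    using comm_group_tuples coset_hom
    by (simp add: group_hom_def group_hom_axioms_def comm_group_def T.is_group)
  obtain x where x: "x \<in> carrier (tuples_group A m)" "U = ?c x"
    using U by (rule tensor_power_coset_cases)
  \<comment> \<open>Induction on the free abelian group builds differences, so the claim is
    strengthened to include the inverse.\<close>
  have "P (?c x) \<and> P (inv\<^bsub>tensor_power A B m\<^esub> (?c x))"
    using x(1) unfolding tuples_group_simps
  proof (induction x rule: free_Abelian_group_induct[consumes 1, case_names 1 2 3])
    case 1
    have "tensor ([] @ \<zero> # replicate (m - 1) \<zero>) = \<one>\<^bsub>tensor_power A B m\<^esub>"
      using m by (intro tensor_zero) auto
    then have "P \<one>\<^bsub>tensor_power A B m\<^esub>"
      using tensor[of "\<zero> # replicate (m - 1) \<zero>"] m by (simp add: in_lists_conv_set)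
    then show ?case
      using c.hom_one by simp
  next
    case (2 x y)
    have xy: "x \<in> carrier (tuples_group A m)" "- y \<in> carrier (tuples_group A m)"
      "y \<in> carrier (tuples_group A m)"
      using 2 by simp_all
    have "?c (x - y) = ?c x \<otimes>\<^bsub>tensor_power A B m\<^esub> inv\<^bsub>tensor_power A B m\<^esub> (?c y)"
      using c.hom_mult[OF xy(1,2)] c.hom_inv[OF xy(3)] xy by simp
    moreover have "inv\<^bsub>tensor_power A B m\<^esub> (?c x \<otimes>\<^bsub>tensor_power A B m\<^esub> inv\<^bsub>tensor_power A B m\<^esub> (?c y)) =
        inv\<^bsub>tensor_power A B m\<^esub> (?c x) \<otimes>\<^bsub>tensor_power A B m\<^esub> ?c y"
      using c.hom_closed[OF xy(1)] c.hom_closed[OF xy(3)] by (simp add: T.inv_mult)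
    ultimately show ?case
      using 2 c.hom_closed[OF xy(1)] c.hom_closed[OF xy(3)] by (simp add: add)
  next
    case (3 as)
    obtain a bs where as: "as = a # bs" using 3 m by (cases as) auto
    have "tensor ([] @ (\<ominus> a) # bs) = inv\<^bsub>tensor_power A B m\<^esub> (tensor ([] @ a # bs))"
      using 3 as by (intro tensor_uminus) auto
    moreover have "P (tensor as)" "P (tensor ((\<ominus> a) # bs))"
      using 3 as by (auto simp: in_lists_conv_set intro!: tensor)
    moreover have "tensor as = ?c (frag_of as)"
      using 3 by (simp add: tensor_def)
    ultimately show ?case by (simp add: as)
  qed
  then show ?thesis using x by simp
qed

section \<open>The two actions of \<open>A\<close> on a tensor power\<close>

text \<open>The actions are defined as unions over all representatives of a coset. If the map on
  tuples sends relators to relations, the images of all representatives lie in one coset, and the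
  union collapses to it.\<close>

lemma coset_extend:
  assumes g: "\<And>as. as \<in> lists (carrier A) \<Longrightarrow> length as = m \<Longrightarrow> g as \<in> lists (carrier A) \<and> length (g as) = m"
    and rel: "\<And>t. t \<in> tensor_relators A B m \<Longrightarrow> frag_extend (\<lambda>as. frag_of (g as)) t \<in> relations m"
    and x: "x \<in> carrier (tuples_group A m)"
  shows "(\<Union>y \<in> relations m #>\<^bsub>tuples_group A m\<^esub> x.
      relations m #>\<^bsub>tuples_group A m\<^esub> frag_extend (\<lambda>as. frag_of (g as)) y) =
    relations m #>\<^bsub>tuples_group A m\<^esub> frag_extend (\<lambda>as. frag_of (g as)) x"
proof -
  let ?E = "frag_extend (\<lambda>as. frag_of (g as))"
  interpret F: comm_group "tuples_group A m" by (rule comm_group_tuples)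
  \<comment> \<open>The elements sent into the relations form a subgroup; it contains the relators,
    hence everything they generate.\<close>
  have "relations m \<subseteq> {y \<in> carrier (tuples_group A m). ?E y \<in> relations m}"
  proof (rule F.generate_subgroup_incl)
    show "tensor_relators A B m \<subseteq> {y \<in> carrier (tuples_group A m). ?E y \<in> relations m}"
      using rel tensor_relators_closed by blast
    show "subgroup {y \<in> carrier (tuples_group A m). ?E y \<in> relations m} (tuples_group A m)"
    proof (rule F.subgroupI)
      fix a b assume a: "a \<in> {y \<in> carrier (tuples_group A m). ?E y \<in> relations m}"
      then show "inv\<^bsub>tuples_group A m\<^esub> a \<in> {y \<in> carrier (tuples_group A m). ?E y \<in> relations m}"
        by (simp add: frag_extend_minus relations_uminus)
      assume "b \<in> {y \<in> carrier (tuples_group A m). ?E y \<in> relations m}"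
      with a show "a \<otimes>\<^bsub>tuples_group A m\<^esub> b \<in> {y \<in> carrier (tuples_group A m). ?E y \<in> relations m}"
        using order_trans[OF keys_add Un_least, of a _ b] by (simp add: frag_extend_add relations_add)
    qed (use relations_zero in force)+
  qed
  then have "relations m #>\<^bsub>tuples_group A m\<^esub> ?E (n + x) = relations m #>\<^bsub>tuples_group A m\<^esub> ?E x"
    if "n \<in> relations m" for n
    using that by (intro coset_eqI) (auto simp: frag_extend_add)
  moreover have "relations m \<noteq> {}"
    using relations_zero by blast
  ultimately show ?thesis
    by (simp add: coset_eq_image[of m x])
qed


text \<open>Left multiplication touches only the first entry. If a relator is based further right,
  its prefix changes and it stays a relator. If it is based at the first entry, distributivity or
  associativity turns it into the relator with \<open>x\<close> (and \<open>y\<close> in the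
  additive case) multiplied by \<open>a\<close>.\<close>

lemma lact_coset:
  assumes m: "m \<ge> 1" and a: "a \<in> carrier A" and x: "x \<in> carrier (tuples_group A m)"
  shows "lact (tensor_power A B m) a (relations m #>\<^bsub>tuples_group A m\<^esub> x) =
    relations m #>\<^bsub>tuples_group A m\<^esub> frag_extend (\<lambda>as. frag_of ((a \<otimes> hd as) # tl as)) x"
  (is "_ = _ #>\<^bsub>_\<^esub> ?E x")
proof -
  have "(a \<otimes> hd as) # tl as \<in> lists (carrier A) \<and> length ((a \<otimes> hd as) # tl as) = m"
    if "as \<in> lists (carrier A)" "length as = m" for as
    using that m a by (cases as) auto
  moreover have "?E t \<in> relations m" if "t \<in> tensor_relators A B m" for t
    using that
  proof (cases rule: tensor_relators_cases)
    case (add us x y vs)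
    show ?thesis
    proof (cases us)
      case Nil
      then show ?thesis
        using add a additivity_relation[of "[]" vs "a \<otimes> x" "a \<otimes> y" m]
        by (simp add: frag_extend_diff r_distr)
    next
      case (Cons u us')
      then show ?thesis
        using add a additivity_relation[of "(a \<otimes> u) # us'" vs x y m]
        by (simp add: frag_extend_diff)
    qed
  next
    case (balance us x b y vs)
    show ?thesis
    proof (cases us)
      case Nil
      then show ?thesis
        using balance a balancing_relation[of "[]" vs "a \<otimes> x" y b m]
        by (simp add: frag_extend_diff m_assoc subset)
    next
      case (Cons u us')
      then show ?thesis
        using balance a balancing_relation[of "(a \<otimes> u) # us'" vs x y b m]
        by (simp add: frag_extend_diff)
    qed
  qed
  ultimately show ?thesis
    using coset_extend[of m "\<lambda>as. (a \<otimes> hd as) # tl as", OF _ _ x]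
    by (simp add: tensor_power_def Let_def)
qed

text \<open>Mirror image of \<open>lact_coset\<close>: the case distinction is whether the relator
  reaches the last entry.\<close>

lemma ract_coset:
  assumes m: "m \<ge> 1" and a: "a \<in> carrier A" and x: "x \<in> carrier (tuples_group A m)"
  shows "ract (tensor_power A B m) (relations m #>\<^bsub>tuples_group A m\<^esub> x) a =
    relations m #>\<^bsub>tuples_group A m\<^esub> frag_extend (\<lambda>as. frag_of (butlast as @ [last as \<otimes> a])) x"
  (is "_ = _ #>\<^bsub>_\<^esub> ?E x")
proof -
  have "butlast as @ [last as \<otimes> a] \<in> lists (carrier A) \<and> length (butlast as @ [last as \<otimes> a]) = m"
    if "as \<in> lists (carrier A)" "length as = m" for as
    using that m a by (cases as rule: rev_cases) auto
  moreover have "?E t \<in> relations m" if "t \<in> tensor_relators A B m" for t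
    using that
  proof (cases rule: tensor_relators_cases)
    case (add us x y vs)
    show ?thesis
    proof (cases vs rule: rev_cases)
      case Nil
      then show ?thesis
        using add a additivity_relation[of us "[]" "x \<otimes> a" "y \<otimes> a" m]
        by (simp add: frag_extend_diff l_distr)
    next
      case (snoc vs' v)
      then show ?thesis
        using add a additivity_relation[of us "vs' @ [v \<otimes> a]" x y m]
        by (simp add: frag_extend_diff butlast_append)
    qed
  next
    case (balance us x b y vs)
    show ?thesis
    proof (cases vs rule: rev_cases)
      case Nil
      then show ?thesis
        using balance a balancing_relation[of us "[]" x "y \<otimes> a" b m]
        by (simp add: frag_extend_diff m_assoc subset butlast_append)
    next
      case (snoc vs' v)
      then show ?thesis
        using balance a balancing_relation[of us "vs' @ [v \<otimes> a]" x y b m]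
        by (simp add: frag_extend_diff butlast_append)
    qed
  qed
  ultimately show ?thesis
    using coset_extend[of m "\<lambda>as. butlast as @ [last as \<otimes> a]", OF _ _ x]
    by (simp add: tensor_power_def Let_def)
qed

lemma lact_tensor:
  assumes "a \<in> carrier A" "x \<in> carrier A" "xs \<in> lists (carrier A)" "m = Suc (length xs)"
  shows "lact (tensor_power A B m) a (tensor (x # xs)) = tensor ((a \<otimes> x) # xs)"
  using lact_coset[of m a "frag_of (x # xs)"] assms by (simp add: tensor_def)

lemma ract_tensor:
  assumes "a \<in> carrier A" "x \<in> carrier A" "xs \<in> lists (carrier A)" "m = Suc (length xs)"
  shows "ract (tensor_power A B m) (tensor (xs @ [x])) a = tensor (xs @ [x \<otimes> a])"
  using ract_coset[of m a "frag_of (xs @ [x])"] assms by (simp add: tensor_def)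

lemma coset_extend_hom:
  assumes f: "\<And>x. x \<in> carrier (tuples_group A m) \<Longrightarrow> f (relations m #>\<^bsub>tuples_group A m\<^esub> x) =
      relations m #>\<^bsub>tuples_group A m\<^esub> frag_extend (\<lambda>as. frag_of (g as)) x"
    and g: "\<And>as. as \<in> lists (carrier A) \<Longrightarrow> length as = m \<Longrightarrow> g as \<in> lists (carrier A) \<and> length (g as) = m"
  shows "f \<in> hom (tensor_power A B m) (tensor_power A B m)"
proof (rule homI)
  let ?c = "\<lambda>x. relations m #>\<^bsub>tuples_group A m\<^esub> x" and ?E = "frag_extend (\<lambda>as. frag_of (g as))"
  have E: "?E x \<in> carrier (tuples_group A m)" if "x \<in> carrier (tuples_group A m)" for x
    using that unfolding tuples_group_simps by (rule keys_frag_extend_subset) (use g in blast)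
  have add: "x + y \<in> carrier (tuples_group A m)"
    if "x \<in> carrier (tuples_group A m)" "y \<in> carrier (tuples_group A m)" for x y
    using that by (simp only: tuples_group_simps) (rule order_trans[OF keys_add Un_least])
  fix U assume "U \<in> carrier (tensor_power A B m)"
  then obtain x where x: "x \<in> carrier (tuples_group A m)" "U = ?c x"
    by (rule tensor_power_coset_cases)
  show "f U \<in> carrier (tensor_power A B m)"
    unfolding x(2) f[OF x(1)] by (rule hom_in_carrier[OF coset_hom E[OF x(1)]])
  fix V assume "V \<in> carrier (tensor_power A B m)"
  then obtain y where y: "y \<in> carrier (tuples_group A m)" "V = ?c y"
    by (rule tensor_power_coset_cases)
  have "f (?c (x + y)) = ?c (?E x + ?E y)"
    using f[OF add[OF x(1) y(1)]] by (simp add: frag_extend_add)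
  then show "f (U \<otimes>\<^bsub>tensor_power A B m\<^esub> V) = f U \<otimes>\<^bsub>tensor_power A B m\<^esub> f V"
    unfolding x(2) y(2) f[OF x(1)] f[OF y(1)]
    by (simp only: coset_add[OF x(1) y(1)] coset_add[OF E[OF x(1)] E[OF y(1)]])
qed

lemma lact_hom:
  assumes "m \<ge> 1" "a \<in> carrier A"
  shows "lact (tensor_power A B m) a \<in> hom (tensor_power A B m) (tensor_power A B m)"
proof (rule coset_extend_hom)
  show "(a \<otimes> hd as) # tl as \<in> lists (carrier A) \<and> length ((a \<otimes> hd as) # tl as) = m"
    if "as \<in> lists (carrier A)" "length as = m" for as
    using that assms by (cases as) auto
qed (rule lact_coset[OF assms])

lemma ract_hom:
  assumes "m \<ge> 1" "a \<in> carrier A"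
  shows "(\<lambda>U. ract (tensor_power A B m) U a) \<in> hom (tensor_power A B m) (tensor_power A B m)"
proof (rule coset_extend_hom)
  show "butlast as @ [last as \<otimes> a] \<in> lists (carrier A) \<and> length (butlast as @ [last as \<otimes> a]) = m"
    if "as \<in> lists (carrier A)" "length as = m" for as
    using that assms by (cases as rule: rev_cases) auto
qed (rule ract_coset[OF assms])

text \<open>The main tool for identities in tensor powers: once both sides are known to be additive,
  only pure tensors remain to be compared.\<close>

lemma tensor_power_hom_eqI:
  assumes "comm_group G" "f \<in> hom (tensor_power A B m) G" "g \<in> hom (tensor_power A B m) G"
    and "\<And>as. as \<in> lists (carrier A) \<Longrightarrow> length as = m \<Longrightarrow> f (tensor as) = g (tensor as)"
    and "m \<ge> 1" "U \<in> carrier (tensor_power A B m)"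
  shows "f U = g U"
  using assms(6,5)
proof (induction U rule: tensor_power_induct)
  case (add x y)
  then show ?case
    using hom_mult[OF assms(2)] hom_mult[OF assms(3)] by simp
qed (rule assms(4))

lemma bimodule_tensor_power:
  assumes m: "m \<ge> 1"
  shows "bimodule A A (tensor_power A B m)"
proof -
  let ?T = "tensor_power A B m"
  note lh = lact_hom[OF m] and rh = ract_hom[OF m]
  note T = comm_group_tensor_power[of m]
  note eqI = tensor_power_hom_eqI[OF T _ _ _ m]
  have id: "(\<lambda>x. x) \<in> hom ?T ?T" by (auto simp: hom_def)
  \<comment> \<open>\<open>Cons\<close> exposes the first entry, on which the left action operates,
    and \<open>snoc\<close> the last one, for the right action. Each bimodule axiom is then a ring
    law in that entry.\<close>
  have Cons: thesis if "as \<in> lists (carrier A)" "length as = m"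
    "\<And>x xs. as = x # xs \<Longrightarrow> x \<in> carrier A \<Longrightarrow> xs \<in> lists (carrier A) \<Longrightarrow> m = Suc (length xs) \<Longrightarrow> thesis"
    for as thesis
    using that m by (cases as) auto
  have snoc: thesis if "as \<in> lists (carrier A)" "length as = m"
    "\<And>x xs. as = xs @ [x] \<Longrightarrow> x \<in> carrier A \<Longrightarrow> xs \<in> lists (carrier A) \<Longrightarrow> m = Suc (length xs) \<Longrightarrow> thesis"
    for as thesis
    using that m by (cases as rule: rev_cases) auto
  have "bimodule_axioms A A ?T"
  proof
    fix a x y assume a: "a \<in> carrier A" and x: "x \<in> carrier ?T" and y: "y \<in> carrier ?T"
    show "lact ?T a x \<in> carrier ?T"
      using lh[OF a] x by (rule hom_in_carrier)
    show "ract ?T x a \<in> carrier ?T"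
      using rh[OF a] x by (rule hom_in_carrier)
    show "lact ?T a (x \<otimes>\<^bsub>?T\<^esub> y) = lact ?T a x \<otimes>\<^bsub>?T\<^esub> lact ?T a y"
      using lh[OF a] x y by (rule hom_mult)
    show "ract ?T (x \<otimes>\<^bsub>?T\<^esub> y) a = ract ?T x a \<otimes>\<^bsub>?T\<^esub> ract ?T y a"
      using rh[OF a] x y by (rule hom_mult)
  next
    fix a b x assume a: "a \<in> carrier A" and b: "b \<in> carrier A" and x: "x \<in> carrier ?T"
    show "lact ?T (a \<oplus> b) x = lact ?T a x \<otimes>\<^bsub>?T\<^esub> lact ?T b x"
    proof (rule eqI[OF lh[OF add.m_closed[OF a b]] hom_mult_fun[OF T lh[OF a] lh[OF b]] _ x])
      fix as assume "as \<in> lists (carrier A)" "length as = m"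
      then show "lact ?T (a \<oplus> b) (tensor as) = lact ?T a (tensor as) \<otimes>\<^bsub>?T\<^esub> lact ?T b (tensor as)"
      proof (rule Cons)
        fix c cs assume c: "as = c # cs" "c \<in> carrier A" "cs \<in> lists (carrier A)" "m = Suc (length cs)"
        then show ?thesis
          using a b tensor_add[of "[]" cs "a \<otimes> c" "b \<otimes> c" m]
          by (simp add: lact_tensor l_distr)
      qed
    qed
    show "ract ?T x (a \<oplus> b) = ract ?T x a \<otimes>\<^bsub>?T\<^esub> ract ?T x b"
    proof (rule eqI[OF rh[OF add.m_closed[OF a b]] hom_mult_fun[OF T rh[OF a] rh[OF b]] _ x])
      fix as assume "as \<in> lists (carrier A)" "length as = m"
      then show "ract ?T (tensor as) (a \<oplus> b) = ract ?T (tensor as) a \<otimes>\<^bsub>?T\<^esub> ract ?T (tensor as) b"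
      proof (rule snoc)
        fix c cs assume c: "as = cs @ [c]" "c \<in> carrier A" "cs \<in> lists (carrier A)" "m = Suc (length cs)"
        then show ?thesis
          using a b tensor_add[of cs "[]" "c \<otimes> a" "c \<otimes> b" m]
          by (simp add: ract_tensor r_distr)
      qed
    qed
    show "lact ?T (a \<otimes> b) x = lact ?T a (lact ?T b x)"
    proof (rule eqI[OF lh[OF m_closed[OF a b]] hom_comp_fun[OF lh[OF b] lh[OF a]] _ x])
      fix as assume "as \<in> lists (carrier A)" "length as = m"
      then show "lact ?T (a \<otimes> b) (tensor as) = lact ?T a (lact ?T b (tensor as))"
        by (rule Cons) (use a b in \<open>simp add: lact_tensor m_assoc\<close>)
    qed
    show "ract ?T x (a \<otimes> b) = ract ?T (ract ?T x a) b"
    proof (rule eqI[OF rh[OF m_closed[OF a b]] hom_comp_fun[OF rh[OF a] rh[OF b]] _ x])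
      fix as assume "as \<in> lists (carrier A)" "length as = m"
      then show "ract ?T (tensor as) (a \<otimes> b) = ract ?T (ract ?T (tensor as) a) b"
        by (rule snoc) (use a b in \<open>simp add: ract_tensor m_assoc\<close>)
    qed
    show "ract ?T (lact ?T a x) b = lact ?T a (ract ?T x b)"
    proof (rule eqI[OF hom_comp_fun[OF lh[OF a] rh[OF b]] hom_comp_fun[OF rh[OF b] lh[OF a]] _ x])
      fix as assume "as \<in> lists (carrier A)" "length as = m"
      then show "ract ?T (lact ?T a (tensor as)) b = lact ?T a (ract ?T (tensor as) b)"
      proof (rule Cons)
        fix c cs assume c: "as = c # cs" "c \<in> carrier A" "cs \<in> lists (carrier A)" "m = Suc (length cs)"
        \<comment> \<open>With one factor both actions meet in the same entry and commute by
          associativity; with more factors they affect different entries.\<close>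
        show ?thesis
        proof (cases cs rule: rev_cases)
          case Nil
          then show ?thesis
            using c a b ract_tensor[of b c "[]" m] ract_tensor[of b "a \<otimes> c" "[]" m]
            by (simp add: lact_tensor m_assoc)
        next
          case (snoc ds d)
          then show ?thesis
            using c a b ract_tensor[of b d "c # ds" m] ract_tensor[of b d "(a \<otimes> c) # ds" m]
            by (simp add: lact_tensor)
        qed
      qed
    qed
  next
    fix x assume x: "x \<in> carrier ?T"
    show "lact ?T \<one> x = x"
    proof (rule eqI[OF lh[OF one_closed] id _ x])
      fix as assume "as \<in> lists (carrier A)" "length as = m"
      then show "lact ?T \<one> (tensor as) = tensor as"
        by (rule Cons) (simp add: lact_tensor)
    qed
    show "ract ?T x \<one> = x"
    proof (rule eqI[OF rh[OF one_closed] id _ x])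
      fix as assume "as \<in> lists (carrier A)" "length as = m"
      then show "ract ?T (tensor as) \<one> = tensor as"
        by (rule snoc) (simp add: ract_tensor)
    qed
  qed
  then show ?thesis
    using ring_axioms T by (simp add: bimodule_def)
qed

end


section \<open>Criteria for depth at most three\<close>

lemma regular_bimodule_simps [simp]:
  "carrier (regular_bimodule A) = carrier A"
  "monoid.mult (regular_bimodule A) = add A"
  "\<one>\<^bsub>regular_bimodule A\<^esub> = \<zero>\<^bsub>A\<^esub>"
  "lact (regular_bimodule A) = monoid.mult A"
  "ract (regular_bimodule A) = monoid.mult A"
  by (simp_all add: regular_bimodule_def)

lemma (in ring) bimodule_regular: "bimodule R R (regular_bimodule R)"
proof -
  have "comm_group (regular_bimodule R)"
    by (rule comm_groupI) (auto simp: a_ac intro: add.l_inv_ex)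
  moreover have "bimodule_axioms R R (regular_bimodule R)"
    by unfold_locales (simp_all add: l_distr r_distr m_assoc)
  ultimately show ?thesis
    using ring_axioms by (simp add: bimodule_def)
qed

context ring_extension
begin

lemma ring_subring: "ring (A\<lparr>carrier := B\<rparr>)"
  using subring by (rule subring_is_ring)

text \<open>The two rings over which the depth conditions are stated. Treating them uniformly lets
  one construction of maps serve B-B-, A-B- and B-A-bimodules alike.\<close>

definition scalar_ring :: "('a, 'c) ring_scheme \<Rightarrow> bool"
  where "scalar_ring R \<longleftrightarrow> R = A \<or> R = A\<lparr>carrier := B\<rparr>"

lemma scalar_ring_simps:
  assumes "scalar_ring R"
  shows "ring R" "carrier R \<subseteq> carrier A" "monoid.mult R = monoid.mult A" "add R = add A" "\<one>\<^bsub>R\<^esub> = \<one>"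
  using assms ring_axioms ring_subring subset by (auto simp: scalar_ring_def)

lemma scalar_ringI [simp]: "scalar_ring A" "scalar_ring (A\<lparr>carrier := B\<rparr>)"
  by (simp_all add: scalar_ring_def)

lemma bimodule_restrict_scalars:
  fixes M :: "('a, 'a, 'm) bimodule"
  assumes "bimodule A A M" "scalar_ring R" "scalar_ring S"
  shows "bimodule R S M"
  using assms(1) by (rule bimodule_restrict)
    (simp_all add: scalar_ring_simps[OF assms(2)] scalar_ring_simps[OF assms(3)])

lemma bimodule_tensor:
  assumes "scalar_ring R" "scalar_ring S" "m \<ge> 1"
  shows "bimodule R S (tensor_power A B m)"
  using assms by (intro bimodule_restrict_scalars[OF bimodule_tensor_power])

text \<open>For a fixed scalar, both sides of a linearity condition are additive in the element, so
  the condition follows from its instances on pure tensors.\<close>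

lemma bimod_hom_tensor_powerI:
  assumes R: "scalar_ring R" and S: "scalar_ring S" and m: "m \<ge> 1"
    and N: "bimodule R S N" and h: "h \<in> hom (tensor_power A B m) N"
    and l: "\<And>r as. \<lbrakk>r \<in> carrier R; as \<in> lists (carrier A); length as = m\<rbrakk>
      \<Longrightarrow> h (lact (tensor_power A B m) r (tensor as)) = lact N r (h (tensor as))"
    and r: "\<And>s as. \<lbrakk>s \<in> carrier S; as \<in> lists (carrier A); length as = m\<rbrakk>
      \<Longrightarrow> h (ract (tensor_power A B m) (tensor as) s) = ract N (h (tensor as)) s"
  shows "h \<in> bimod_hom R S (tensor_power A B m) N"
proof (rule bimod_homI[OF h])
  interpret N: bimodule R S N by fact
  note eqI = tensor_power_hom_eqI[OF N.comm_group_axioms _ _ _ m]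
  fix x assume x: "x \<in> carrier (tensor_power A B m)"
  show "h (lact (tensor_power A B m) r x) = lact N r (h x)" if r: "r \<in> carrier R" for r
  proof (rule eqI[OF hom_comp_fun[OF lact_hom[OF m] h] hom_comp_fun[OF h] l[OF r] x])
    show "r \<in> carrier A" using r scalar_ring_simps(2)[OF R] by blast
    show "lact N r \<in> hom N N"
      using r by (simp add: hom_def Pi_iff N.lact_closed N.lact_add_right)
  qed
  show "h (ract (tensor_power A B m) x s) = ract N (h x) s" if s: "s \<in> carrier S" for s
  proof (rule eqI[OF hom_comp_fun[OF ract_hom[OF m] h] hom_comp_fun[OF h] r[OF s] x])
    show "s \<in> carrier A" using s scalar_ring_simps(2)[OF S] by blast
    show "(\<lambda>x. ract N x s) \<in> hom N N"
      using s by (simp add: hom_def Pi_iff N.ract_closed N.ract_add_left)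
  qed
qed

section \<open>Tensor powers with one and two factors\<close>

lemma tensor1_add:
  "x \<in> carrier A \<Longrightarrow> y \<in> carrier A \<Longrightarrow>
    tensor [x \<oplus> y] = tensor [x] \<otimes>\<^bsub>tensor_power A B 1\<^esub> tensor [y]"
  using tensor_add[of "[]" "[]" x y 1] by simp

lemma tensor1_lact:
  "a \<in> carrier A \<Longrightarrow> x \<in> carrier A \<Longrightarrow> lact (tensor_power A B 1) a (tensor [x]) = tensor [a \<otimes> x]"
  using lact_tensor[of a x "[]" 1] by simp

lemma tensor1_ract:
  "a \<in> carrier A \<Longrightarrow> x \<in> carrier A \<Longrightarrow> ract (tensor_power A B 1) (tensor [x]) a = tensor [x \<otimes> a]"
  using ract_tensor[of a x "[]" 1] by simp

lemma tensor1_closed: "x \<in> carrier A \<Longrightarrow> tensor [x] \<in> carrier (tensor_power A B 1)"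
  by (rule tensor_closed) auto

lemma tensor2_add_left:
  "x \<in> carrier A \<Longrightarrow> x' \<in> carrier A \<Longrightarrow> y \<in> carrier A \<Longrightarrow>
    tensor [x \<oplus> x', y] = tensor [x, y] \<otimes>\<^bsub>tensor_power A B 2\<^esub> tensor [x', y]"
  using tensor_add[of "[]" "[y]" x x' 2] by simp

lemma tensor2_add_right:
  "x \<in> carrier A \<Longrightarrow> y \<in> carrier A \<Longrightarrow> y' \<in> carrier A \<Longrightarrow>
    tensor [x, y \<oplus> y'] = tensor [x, y] \<otimes>\<^bsub>tensor_power A B 2\<^esub> tensor [x, y']"
  using tensor_add[of "[x]" "[]" y y' 2] by simp

lemma tensor2_balanced:
  "x \<in> carrier A \<Longrightarrow> b \<in> B \<Longrightarrow> y \<in> carrier A \<Longrightarrow> tensor [x \<otimes> b, y] = tensor [x, b \<otimes> y]"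
  using tensor_balanced[of "[]" "[]" x y b] by simp

lemma tensor2_lact:
  "a \<in> carrier A \<Longrightarrow> x \<in> carrier A \<Longrightarrow> y \<in> carrier A \<Longrightarrow>
    lact (tensor_power A B 2) a (tensor [x, y]) = tensor [a \<otimes> x, y]"
  using lact_tensor[of a x "[y]" 2] by simp

lemma tensor2_ract:
  "a \<in> carrier A \<Longrightarrow> x \<in> carrier A \<Longrightarrow> y \<in> carrier A \<Longrightarrow>
    ract (tensor_power A B 2) (tensor [x, y]) a = tensor [x, y \<otimes> a]"
  using ract_tensor[of a y "[x]" 2] by simp

lemma tensor2_closed:
  "x \<in> carrier A \<Longrightarrow> y \<in> carrier A \<Longrightarrow> tensor [x, y] \<in> carrier (tensor_power A B 2)"
  by (rule tensor_closed) auto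

lemma list1_cases:
  assumes "as \<in> lists (carrier A)" "length as = 1"
  obtains x where "as = [x]" "x \<in> carrier A"
  using assms by (cases as) auto

lemma list2_cases:
  assumes "as \<in> lists (carrier A)" "length as = 2"
  obtains x y where "as = [x, y]" "x \<in> carrier A" "y \<in> carrier A"
  using assms by (cases as; cases "tl as") auto

text \<open>The one-factor power is a copy of \<open>A\<close> whose elements are cosets. Balancing
  relators need two neighbouring entries, so the only condition for a map to exist is additivity;
  the other conditions give linearity.\<close>

lemma tensor1_hom_exists:
  assumes R: "scalar_ring R" and S: "scalar_ring S" and N: "bimodule R S N"
    and closed: "\<And>x. x \<in> carrier A \<Longrightarrow> f x \<in> carrier N"
    and add: "\<And>x y. x \<in> carrier A \<Longrightarrow> y \<in> carrier A \<Longrightarrow> f (x \<oplus> y) = f x \<otimes>\<^bsub>N\<^esub> f y"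
    and l: "\<And>r x. r \<in> carrier R \<Longrightarrow> x \<in> carrier A \<Longrightarrow> f (r \<otimes> x) = lact N r (f x)"
    and r: "\<And>s x. s \<in> carrier S \<Longrightarrow> x \<in> carrier A \<Longrightarrow> f (x \<otimes> s) = ract N (f x) s"
  obtains h where "h \<in> bimod_hom R S (tensor_power A B 1) N"
    "\<And>x. x \<in> carrier A \<Longrightarrow> h (tensor [x]) = f x"
proof -
  interpret N: bimodule R S N by fact
  obtain h where h: "h \<in> hom (tensor_power A B 1) N"
    "\<And>as. as \<in> lists (carrier A) \<Longrightarrow> length as = 1 \<Longrightarrow> h (tensor as) = f (hd as)"
  proof (rule tensor_power_hom_exists[OF N.comm_group_axioms, of 1 "\<lambda>as. f (hd as)"])
    fix as assume "as \<in> lists (carrier A)" "length as = 1"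
    then show "f (hd as) \<in> carrier N"
      by (rule list1_cases) (simp add: closed)
  qed (auto simp: add)
  have hx: "h (tensor [x]) = f x" if "x \<in> carrier A" for x
    using that h(2)[of "[x]"] by simp
  have sub: "r \<in> carrier R \<Longrightarrow> r \<in> carrier A" "s \<in> carrier S \<Longrightarrow> s \<in> carrier A" for r s
    using scalar_ring_simps(2)[OF R] scalar_ring_simps(2)[OF S] by blast+
  show thesis
  proof (rule that[OF bimod_hom_tensor_powerI[OF R S _ N h(1)] hx])
    fix s as assume s: "s \<in> carrier R" and as: "as \<in> lists (carrier A)" "length as = 1"
    obtain x where x: "as = [x]" "x \<in> carrier A"
      using as by (rule list1_cases)
    show "h (lact (tensor_power A B 1) s (tensor as)) = lact N s (h (tensor as))"
      using x s sub(1)[OF s] by (simp only: tensor1_lact hx l m_closed)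
  next
    fix s as assume s: "s \<in> carrier S" and as: "as \<in> lists (carrier A)" "length as = 1"
    obtain x where x: "as = [x]" "x \<in> carrier A"
      using as by (rule list1_cases)
    show "h (ract (tensor_power A B 1) (tensor as) s) = ract N (h (tensor as)) s"
      using x s sub(2)[OF s] by (simp only: tensor1_ract hx r m_closed)
  qed simp
qed

lemma tensor2_hom_exists:
  assumes R: "scalar_ring R" and S: "scalar_ring S" and N: "bimodule R S N"
    and closed: "\<And>x y. x \<in> carrier A \<Longrightarrow> y \<in> carrier A \<Longrightarrow> f x y \<in> carrier N"
    and add: "\<And>x x' y. x \<in> carrier A \<Longrightarrow> x' \<in> carrier A \<Longrightarrow> y \<in> carrier A \<Longrightarrow>
        f (x \<oplus> x') y = f x y \<otimes>\<^bsub>N\<^esub> f x' y"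
      "\<And>x y y'. x \<in> carrier A \<Longrightarrow> y \<in> carrier A \<Longrightarrow> y' \<in> carrier A \<Longrightarrow>
        f x (y \<oplus> y') = f x y \<otimes>\<^bsub>N\<^esub> f x y'"
    and bal: "\<And>x b y. x \<in> carrier A \<Longrightarrow> b \<in> B \<Longrightarrow> y \<in> carrier A \<Longrightarrow> f (x \<otimes> b) y = f x (b \<otimes> y)"
    and l: "\<And>r x y. r \<in> carrier R \<Longrightarrow> x \<in> carrier A \<Longrightarrow> y \<in> carrier A \<Longrightarrow>
        f (r \<otimes> x) y = lact N r (f x y)"
    and r: "\<And>s x y. s \<in> carrier S \<Longrightarrow> x \<in> carrier A \<Longrightarrow> y \<in> carrier A \<Longrightarrow>
        f x (y \<otimes> s) = ract N (f x y) s"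
  obtains h where "h \<in> bimod_hom R S (tensor_power A B 2) N"
    "\<And>x y. x \<in> carrier A \<Longrightarrow> y \<in> carrier A \<Longrightarrow> h (tensor [x, y]) = f x y"
proof -
  interpret N: bimodule R S N by fact
  have "\<exists>h. h \<in> hom (tensor_power A B 2) N \<and>
    (\<forall>as. as \<in> lists (carrier A) \<longrightarrow> length as = 2 \<longrightarrow> h (tensor as) = f (as ! 0) (as ! 1))"
  proof (rule tensor_power_hom_exists[OF N.comm_group_axioms, of 2 "\<lambda>as. f (as ! 0) (as ! 1)"])
    show "f (as ! 0) (as ! 1) \<in> carrier N" if "as \<in> lists (carrier A)" "length as = 2" for as
      using that by (rule list2_cases) (simp add: closed)
    show "f ((us @ (x \<oplus> y) # vs) ! 0) ((us @ (x \<oplus> y) # vs) ! 1) =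
        f ((us @ x # vs) ! 0) ((us @ x # vs) ! 1) \<otimes>\<^bsub>N\<^esub> f ((us @ y # vs) ! 0) ((us @ y # vs) ! 1)"
      if *: "us \<in> lists (carrier A)" "vs \<in> lists (carrier A)" "x \<in> carrier A" "y \<in> carrier A"
        "length us + 1 + length vs = 2" for us vs x y
    proof -
      \<comment> \<open>An additive relator of length 2 concerns either the second entry or the
        first one.\<close>
      consider u where "us = [u]" "vs = []" "u \<in> carrier A" | v where "us = []" "vs = [v]" "v \<in> carrier A"
        using * by (cases us; cases vs) auto
      then show ?thesis
        by cases (use * in \<open>simp_all add: add\<close>)
    qed
    show "f ((us @ (x \<otimes> b) # y # vs) ! 0) ((us @ (x \<otimes> b) # y # vs) ! 1) =
        f ((us @ x # (b \<otimes> y) # vs) ! 0) ((us @ x # (b \<otimes> y) # vs) ! 1)"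
      if "x \<in> carrier A" "y \<in> carrier A" "b \<in> B" "length us + 2 + length vs = 2" for us vs x y b
      using that by (simp add: bal)
  qed blast
  then obtain h where h: "h \<in> hom (tensor_power A B 2) N"
    and h': "\<And>as. as \<in> lists (carrier A) \<Longrightarrow> length as = 2 \<Longrightarrow> h (tensor as) = f (as ! 0) (as ! 1)"
    by blast
  have hx: "h (tensor [x, y]) = f x y" if "x \<in> carrier A" "y \<in> carrier A" for x y
    using that h'[of "[x, y]"] by simp
  have sub: "r \<in> carrier R \<Longrightarrow> r \<in> carrier A" "s \<in> carrier S \<Longrightarrow> s \<in> carrier A" for r s
    using scalar_ring_simps(2)[OF R] scalar_ring_simps(2)[OF S] by blast+
  show thesis
  proof (rule that[OF bimod_hom_tensor_powerI[OF R S _ N h] hx])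
    fix s as assume s: "s \<in> carrier R" and as: "as \<in> lists (carrier A)" "length as = 2"
    obtain x y where x: "as = [x, y]" "x \<in> carrier A" "y \<in> carrier A"
      using as by (rule list2_cases)
    show "h (lact (tensor_power A B 2) s (tensor as)) = lact N s (h (tensor as))"
      using x s sub(1)[OF s] by (simp only: tensor2_lact hx l m_closed)
  next
    fix s as assume s: "s \<in> carrier S" and as: "as \<in> lists (carrier A)" "length as = 2"
    obtain x y where x: "as = [x, y]" "x \<in> carrier A" "y \<in> carrier A"
      using as by (rule list2_cases)
    show "h (ract (tensor_power A B 2) (tensor as) s) = ract N (h (tensor as)) s"
      using x s sub(2)[OF s] by (simp only: tensor2_ract hx r m_closed)
  qed simp_all
qed

text \<open>With a single factor, additivity merges a sum of pure tensors into one.\<close>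

lemma tensor1_cases:
  assumes "U \<in> carrier (tensor_power A B 1)"
  obtains x where "x \<in> carrier A" "U = tensor [x]"
proof -
  have "\<exists>x\<in>carrier A. U = tensor [x]"
    using assms order_refl
  proof (induction U rule: tensor_power_induct)
    case (add u v)
    then obtain x y where "x \<in> carrier A" "y \<in> carrier A" "u = tensor [x]" "v = tensor [y]"
      by blast
    then show ?case
      by (intro bexI[of _ "x \<oplus> y"]) (simp_all add: tensor1_add)
  next
    case (tensor as)
    then show ?case
      by (rule list1_cases) blast
  qed
  then show thesis using that by blast
qed

text \<open>The identity of \<open>A\<close> induces a left inverse of the map from \<open>A\<close>
  to the one-factor power, which is therefore injective.\<close>

lemma tensor1_eq_zero:
  assumes "x \<in> carrier A" "tensor [x] = \<one>\<^bsub>tensor_power A B 1\<^esub>"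
  shows "x = \<zero>"
proof -
  obtain h where h: "h \<in> bimod_hom A A (tensor_power A B 1) (regular_bimodule A)"
    "\<And>x. x \<in> carrier A \<Longrightarrow> h (tensor [x]) = x"
    by (rule tensor1_hom_exists[OF _ _ bimodule_regular, of "\<lambda>x. x"]) auto
  interpret T: bimodule A A "tensor_power A B 1"
    by (rule bimodule_tensor_power) simp
  interpret N: bimodule A A "regular_bimodule A"
    by (rule bimodule_regular)
  have "h \<one>\<^bsub>tensor_power A B 1\<^esub> = \<zero>"
    using hom_one[OF bimod_hom_hom[OF h(1)] T.M.is_group N.M.is_group] by simp
  then show ?thesis
    using h(2)[OF assms(1)] assms(2) by simp
qed

section \<open>Obstructions to depth one and depth two\<close>

text \<open>The divisibility that fails is that of \<open>A\<close> into copies of \<open>B\<close>: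
  a B-B-linear map to \<open>B\<close> sends \<open>x = e x f\<close> into \<open>e B f\<close>,
  which is zero, so no sum of maps through \<open>B\<close> can reproduce \<open>x\<close>.\<close>

lemma not_depth_one:
  assumes "e \<in> B" "f \<in> B" "x \<in> carrier A" "e \<otimes> x \<otimes> f = x" "x \<noteq> \<zero>"
    and "\<And>b. b \<in> B \<Longrightarrow> e \<otimes> b \<otimes> f = \<zero>"
  shows "\<not> C_similar A B (A\<lparr>carrier := B\<rparr>) (A\<lparr>carrier := B\<rparr>) 0"
proof
  let ?B = "A\<lparr>carrier := B\<rparr>"
  assume "C_similar A B ?B ?B 0"
  then obtain k where div: "bimod_divides ?B ?B (tensor_power A B 1) (copies k (regular_bimodule ?B))"
    by (auto simp: C_similar_def H_equivalent_def)
  have T: "bimodule ?B ?B (tensor_power A B 1)"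
    by (rule bimodule_tensor) simp_all
  have N: "bimodule ?B ?B (regular_bimodule ?B)"
    by (rule ring.bimodule_regular[OF ring_subring])
  interpret T: bimodule ?B ?B "tensor_power A B 1" by fact
  interpret N: bimodule ?B ?B "regular_bimodule ?B" by fact
  obtain p q where p: "\<And>i. i < k \<Longrightarrow> p i \<in> bimod_hom ?B ?B (tensor_power A B 1) (regular_bimodule ?B)"
    and q: "\<And>i. i < k \<Longrightarrow> q i \<in> bimod_hom ?B ?B (regular_bimodule ?B) (tensor_power A B 1)"
    and pq: "\<And>x. x \<in> carrier (tensor_power A B 1) \<Longrightarrow>
      finprod (tensor_power A B 1) (\<lambda>i. q i (p i x)) {..<k} = x"
    by (rule bimod_divides_copiesE[OF div T N]) (rule that)
  have x: "tensor [x] \<in> carrier (tensor_power A B 1)"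
    using assms(3) by (rule tensor1_closed)
  have tx: "tensor [x] = ract (tensor_power A B 1) (lact (tensor_power A B 1) e (tensor [x])) f"
    using assms(1-4) subset by (simp only: tensor1_lact tensor1_ract m_closed)
  have "q i (p i (tensor [x])) = \<one>\<^bsub>tensor_power A B 1\<^esub>" if "i < k" for i
  proof -
    have "p i (tensor [x]) = e \<otimes> p i (tensor [x]) \<otimes> f"
      using bimod_hom_lact[OF p[OF that], of e "tensor [x]"]
        bimod_hom_ract[OF p[OF that], of f "lact (tensor_power A B 1) e (tensor [x])"]
        T.lact_closed[of e "tensor [x]"] x assms(1,2) tx by simp
    also have "\<dots> = \<zero>"
      using bimod_hom_closed[OF p[OF that] x] assms(6) by simp
    finally show ?thesis
      using hom_one[OF bimod_hom_hom[OF q[OF that]] N.M.is_group T.M.is_group] by simp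
  qed
  then have "tensor [x] = \<one>\<^bsub>tensor_power A B 1\<^esub>"
    using pq[OF x] T.M.finprod_one_eqI[of "{..<k}" "\<lambda>i. q i (p i (tensor [x]))"] by simp
  then show False
    using tensor1_eq_zero assms by blast
qed

text \<open>In the application \<open>f\<close> is the idempotent at the head of an arrow,
  \<open>x\<close> the arrow, and \<open>P\<close> the projection onto its multiples;
  \<open>h\<close> below is the F of the overview. Assumption \<open>zero\<close> is the abstract
  form of the absence of nontrivial closed paths through the arrow.\<close>

lemma not_right_depth_two:
  fixes P :: "'a \<Rightarrow> 'a"
  assumes P: "\<And>x. x \<in> carrier A \<Longrightarrow> P x \<in> carrier A"
      "\<And>x y. x \<in> carrier A \<Longrightarrow> y \<in> carrier A \<Longrightarrow> P (x \<oplus> y) = P x \<oplus> P y"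
      "\<And>b x. b \<in> B \<Longrightarrow> x \<in> carrier A \<Longrightarrow> P (b \<otimes> x) = b \<otimes> P x"
      "\<And>b x. b \<in> B \<Longrightarrow> x \<in> carrier A \<Longrightarrow> P (x \<otimes> b) = P x \<otimes> b"
    and f: "f \<in> B" "f \<otimes> f = f" and x: "x \<in> carrier A" "x \<otimes> f = x" "P x \<noteq> \<zero>"
    and zero: "\<And>u v. u \<in> carrier A \<Longrightarrow> v \<in> carrier A \<Longrightarrow> f \<otimes> (u \<otimes> P v) \<otimes> f = \<zero>"
  shows "\<not> C_similar A B A (A\<lparr>carrier := B\<rparr>) 1"
proof
  let ?B = "A\<lparr>carrier := B\<rparr>" and ?C1 = "tensor_power A B 1" and ?C2 = "tensor_power A B 2"
  assume "C_similar A B A ?B 1"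
  then obtain k where div: "bimod_divides A ?B ?C2 (copies k ?C1)"
    by (auto simp: C_similar_def H_equivalent_def numeral_2_eq_2)
  have C1: "bimodule A ?B ?C1" and C2: "bimodule A ?B ?C2"
    by (rule bimodule_tensor; simp)+
  have N: "bimodule A ?B (regular_bimodule A)"
    by (rule bimodule_restrict_scalars[OF bimodule_regular]) simp_all
  interpret C1: bimodule A ?B ?C1 by fact
  interpret C2: bimodule A ?B ?C2 by fact
  interpret N: bimodule A ?B "regular_bimodule A" by fact
  note fA = subset[OF f(1)]
  obtain p q where p: "\<And>i. i < k \<Longrightarrow> p i \<in> bimod_hom A ?B ?C2 ?C1"
    and q: "\<And>i. i < k \<Longrightarrow> q i \<in> bimod_hom A ?B ?C1 ?C2"
    and pq: "\<And>x. x \<in> carrier ?C2 \<Longrightarrow> finprod ?C2 (\<lambda>i. q i (p i x)) {..<k} = x"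
    by (rule bimod_divides_copiesE[OF div C2 C1]) (rule that)
  \<comment> \<open>Balancing uses that \<open>P\<close> commutes with \<open>B\<close> on the left,
    right \<open>B\<close>-linearity that it does so on the right. Left \<open>A\<close>-linearity
    holds because the left factor is untouched.\<close>
  obtain h where h: "h \<in> bimod_hom A ?B ?C2 (regular_bimodule A)"
    and hx: "\<And>x y. x \<in> carrier A \<Longrightarrow> y \<in> carrier A \<Longrightarrow> h (tensor [x, y]) = x \<otimes> P y"
    by (rule tensor2_hom_exists[OF _ _ N, of "\<lambda>x y. x \<otimes> P y"])
      (simp_all add: P l_distr r_distr m_assoc subset)
  \<comment> \<open>\<open>h\<close> kills the corner \<open>f C2 f\<close>: there
    \<open>h w = f (h w) f\<close>, and the right side vanishes on every pure tensor by
    \<open>zero\<close>.\<close>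
  have vanish: "h w = \<zero>"
    if w: "w \<in> carrier ?C2" "lact ?C2 f w = w" "ract ?C2 w f = w" for w
  proof -
    have "h w = h (ract ?C2 (lact ?C2 f w) f)"
      using w by simp
    also have "\<dots> = f \<otimes> h w \<otimes> f"
      using bimod_hom_lact[OF h fA w(1)] bimod_hom_ract[OF h _ C2.lact_closed[OF fA w(1)], of f] f(1) by simp
    also have "\<dots> = \<zero>"
    proof (rule tensor_power_hom_eqI[OF N.comm_group_axioms _ _ _ _ w(1)])
      have hh: "h u \<in> carrier A" if "u \<in> carrier ?C2" for u
        using bimod_hom_closed[OF h that] by simp
      show "(\<lambda>w. f \<otimes> h w \<otimes> f) \<in> hom ?C2 (regular_bimodule A)"
        using fA hh bimod_hom_add[OF h] by (intro homI) (simp_all add: r_distr l_distr)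
      show "(\<lambda>_. \<zero>) \<in> hom ?C2 (regular_bimodule A)"
        by (rule homI) simp_all
      fix as assume "as \<in> lists (carrier A)" "length as = 2"
      then show "f \<otimes> h (tensor as) \<otimes> f = \<zero>"
        by (rule list2_cases) (simp add: hx zero)
    qed simp
    finally show ?thesis .
  qed
  let ?z = "tensor [\<one>, x]"
  have z: "?z \<in> carrier ?C2" "ract ?C2 ?z f = ?z"
    using x fA by (simp_all add: tensor2_closed tensor2_ract)
  have hz: "h (q i (p i ?z)) = \<zero>" if i: "i < k" for i
  proof -
    obtain a where a: "a \<in> carrier A" "p i ?z = tensor [a]"
      using bimod_hom_closed[OF p[OF i] z(1)] by (rule tensor1_cases)
    \<comment> \<open>Since \<open>z f = z\<close>, the image of \<open>z\<close> in
      \<open>A\<close> has the form \<open>a f\<close>. Left \<open>A\<close>-linearity then pulls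
      out \<open>a\<close> and leaves the value at \<open>f\<close>, which lies in the corner
      \<open>f C2 f\<close> because \<open>f\<close> is idempotent.\<close>
    have "p i ?z = ract ?C1 (p i ?z) f"
      using bimod_hom_ract[OF p[OF i] _ z(1), of f] f(1) z(2) by simp
    also have "\<dots> = lact ?C1 a (tensor [f])"
      unfolding a(2) using a(1) fA by (simp only: tensor1_ract tensor1_lact)
    finally have "p i ?z = lact ?C1 a (tensor [f])" .
    then have "h (q i (p i ?z)) = a \<otimes> h (q i (tensor [f]))"
      using bimod_hom_lact[OF q[OF i] a(1) tensor1_closed[OF fA]]
        bimod_hom_lact[OF h a(1) bimod_hom_closed[OF q[OF i] tensor1_closed[OF fA]]] by simp
    moreover have "h (q i (tensor [f])) = \<zero>"
    proof (rule vanish)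
      show "q i (tensor [f]) \<in> carrier ?C2"
        using q[OF i] tensor1_closed[OF fA] by (rule bimod_hom_closed)
      show "lact ?C2 f (q i (tensor [f])) = q i (tensor [f])"
        using bimod_hom_lact[OF q[OF i] fA tensor1_closed[OF fA]] tensor1_lact[OF fA fA] f(2) by metis
      show "ract ?C2 (q i (tensor [f])) f = q i (tensor [f])"
        using bimod_hom_ract[OF q[OF i] _ tensor1_closed[OF fA], of f] tensor1_ract[OF fA fA] f by simp
    qed
    ultimately show ?thesis using a by simp
  qed
  have Pi: "(\<lambda>i. q i (p i ?z)) \<in> {..<k} \<rightarrow> carrier ?C2"
    using bimod_hom_closed[OF q bimod_hom_closed[OF p z(1)]] by simp
  have "P x = h ?z"
    using x P(1) by (simp add: hx)
  also have "\<dots> = h (finprod ?C2 (\<lambda>i. q i (p i ?z)) {..<k})"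
    by (simp add: pq[OF z(1)])
  also have "\<dots> = finprod (regular_bimodule A) (\<lambda>i. h (q i (p i ?z))) {..<k}"
    using C2.comm_group_axioms N.comm_group_axioms bimod_hom_hom[OF h] Pi by (rule hom_finprod)
  also have "\<dots> = \<one>\<^bsub>regular_bimodule A\<^esub>"
    by (rule N.finprod_one_eqI) (simp add: hz)
  finally show False
    using x(3) by simp
qed

text \<open>Mirror image of \<open>not_right_depth_two\<close>: the detector applies
  \<open>P\<close> to the left factor, the test element is \<open>x\<close> tensor 1, and in the
  application \<open>e\<close> is the idempotent at the tail of the arrow.\<close>

lemma not_left_depth_two:
  fixes P :: "'a \<Rightarrow> 'a"
  assumes P: "\<And>x. x \<in> carrier A \<Longrightarrow> P x \<in> carrier A"
      "\<And>x y. x \<in> carrier A \<Longrightarrow> y \<in> carrier A \<Longrightarrow> P (x \<oplus> y) = P x \<oplus> P y"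
      "\<And>b x. b \<in> B \<Longrightarrow> x \<in> carrier A \<Longrightarrow> P (b \<otimes> x) = b \<otimes> P x"
      "\<And>b x. b \<in> B \<Longrightarrow> x \<in> carrier A \<Longrightarrow> P (x \<otimes> b) = P x \<otimes> b"
    and e: "e \<in> B" "e \<otimes> e = e" and x: "x \<in> carrier A" "e \<otimes> x = x" "P x \<noteq> \<zero>"
    and zero: "\<And>u v. u \<in> carrier A \<Longrightarrow> v \<in> carrier A \<Longrightarrow> e \<otimes> (P u \<otimes> v) \<otimes> e = \<zero>"
  shows "\<not> C_similar A B (A\<lparr>carrier := B\<rparr>) A 1"
proof
  let ?B = "A\<lparr>carrier := B\<rparr>" and ?C1 = "tensor_power A B 1" and ?C2 = "tensor_power A B 2"
  assume "C_similar A B ?B A 1"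
  then obtain k where div: "bimod_divides ?B A ?C2 (copies k ?C1)"
    by (auto simp: C_similar_def H_equivalent_def numeral_2_eq_2)
  have C1: "bimodule ?B A ?C1" and C2: "bimodule ?B A ?C2"
    by (rule bimodule_tensor; simp)+
  have N: "bimodule ?B A (regular_bimodule A)"
    by (rule bimodule_restrict_scalars[OF bimodule_regular]) simp_all
  interpret C1: bimodule ?B A ?C1 by fact
  interpret C2: bimodule ?B A ?C2 by fact
  interpret N: bimodule ?B A "regular_bimodule A" by fact
  note eA = subset[OF e(1)]
  obtain p q where p: "\<And>i. i < k \<Longrightarrow> p i \<in> bimod_hom ?B A ?C2 ?C1"
    and q: "\<And>i. i < k \<Longrightarrow> q i \<in> bimod_hom ?B A ?C1 ?C2"
    and pq: "\<And>x. x \<in> carrier ?C2 \<Longrightarrow> finprod ?C2 (\<lambda>i. q i (p i x)) {..<k} = x"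
    by (rule bimod_divides_copiesE[OF div C2 C1]) (rule that)
  obtain h where h: "h \<in> bimod_hom ?B A ?C2 (regular_bimodule A)"
    and hx: "\<And>x y. x \<in> carrier A \<Longrightarrow> y \<in> carrier A \<Longrightarrow> h (tensor [x, y]) = P x \<otimes> y"
    by (rule tensor2_hom_exists[OF _ _ N, of "\<lambda>x y. P x \<otimes> y"])
      (simp_all add: P l_distr r_distr m_assoc subset)
  have vanish: "h w = \<zero>"
    if w: "w \<in> carrier ?C2" "lact ?C2 e w = w" "ract ?C2 w e = w" for w
  proof -
    have "h w = h (ract ?C2 (lact ?C2 e w) e)"
      using w by simp
    also have "\<dots> = e \<otimes> h w \<otimes> e"
      using bimod_hom_lact[OF h _ w(1), of e] bimod_hom_ract[OF h eA C2.lact_closed[OF _ w(1)], of e] e(1) by simp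
    also have "\<dots> = \<zero>"
    proof (rule tensor_power_hom_eqI[OF N.comm_group_axioms _ _ _ _ w(1)])
      have hh: "h u \<in> carrier A" if "u \<in> carrier ?C2" for u
        using bimod_hom_closed[OF h that] by simp
      show "(\<lambda>w. e \<otimes> h w \<otimes> e) \<in> hom ?C2 (regular_bimodule A)"
        using eA hh bimod_hom_add[OF h] by (intro homI) (simp_all add: r_distr l_distr)
      show "(\<lambda>_. \<zero>) \<in> hom ?C2 (regular_bimodule A)"
        by (rule homI) simp_all
      fix as assume "as \<in> lists (carrier A)" "length as = 2"
      then show "e \<otimes> h (tensor as) \<otimes> e = \<zero>"
        by (rule list2_cases) (simp add: hx zero)
    qed simp
    finally show ?thesis .
  qed
  let ?z = "tensor [x, \<one>]"
  have z: "?z \<in> carrier ?C2" "lact ?C2 e ?z = ?z"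
    using x eA by (simp_all add: tensor2_closed tensor2_lact)
  have hz: "h (q i (p i ?z)) = \<zero>" if i: "i < k" for i
  proof -
    obtain a where a: "a \<in> carrier A" "p i ?z = tensor [a]"
      using bimod_hom_closed[OF p[OF i] z(1)] by (rule tensor1_cases)
    have "p i ?z = lact ?C1 e (p i ?z)"
      using bimod_hom_lact[OF p[OF i] _ z(1), of e] e(1) z(2) by simp
    also have "\<dots> = ract ?C1 (tensor [e]) a"
      unfolding a(2) using a(1) eA by (simp only: tensor1_ract tensor1_lact)
    finally have "p i ?z = ract ?C1 (tensor [e]) a" .
    then have "h (q i (p i ?z)) = h (q i (tensor [e])) \<otimes> a"
      using bimod_hom_ract[OF q[OF i] a(1) tensor1_closed[OF eA]]
        bimod_hom_ract[OF h a(1) bimod_hom_closed[OF q[OF i] tensor1_closed[OF eA]]] by simp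
    moreover have "h (q i (tensor [e])) = \<zero>"
    proof (rule vanish)
      show "q i (tensor [e]) \<in> carrier ?C2"
        using q[OF i] tensor1_closed[OF eA] by (rule bimod_hom_closed)
      show "ract ?C2 (q i (tensor [e])) e = q i (tensor [e])"
        using bimod_hom_ract[OF q[OF i] eA tensor1_closed[OF eA]] tensor1_ract[OF eA eA] e(2) by metis
      show "lact ?C2 e (q i (tensor [e])) = q i (tensor [e])"
        using bimod_hom_lact[OF q[OF i] _ tensor1_closed[OF eA], of e] tensor1_lact[OF eA eA] e by simp
    qed
    ultimately show ?thesis using a by simp
  qed
  have Pi: "(\<lambda>i. q i (p i ?z)) \<in> {..<k} \<rightarrow> carrier ?C2"
    using bimod_hom_closed[OF q bimod_hom_closed[OF p z(1)]] by simp
  have "P x = h ?z"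
    using x P(1) by (simp add: hx)
  also have "\<dots> = h (finprod ?C2 (\<lambda>i. q i (p i ?z)) {..<k})"
    by (simp add: pq[OF z(1)])
  also have "\<dots> = finprod (regular_bimodule A) (\<lambda>i. h (q i (p i ?z))) {..<k}"
    using C2.comm_group_axioms N.comm_group_axioms bimod_hom_hom[OF h] Pi by (rule hom_finprod)
  also have "\<dots> = \<one>\<^bsub>regular_bimodule A\<^esub>"
    by (rule N.finprod_one_eqI) (simp add: hz)
  finally show False
    using x(3) by simp
qed

section \<open>A sufficient condition for depth three\<close>

lemma tensor2_finsum:
  assumes "finite I" "finite J" "\<And>i. i \<in> I \<Longrightarrow> f i \<in> carrier A" "\<And>j. j \<in> J \<Longrightarrow> g j \<in> carrier A"
  shows "tensor [finsum A f I, finsum A g J] =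
    finprod (tensor_power A B 2) (\<lambda>(i, j). tensor [f i, g j]) (I \<times> J)"
proof -
  let ?C = "tensor_power A B 2"
  interpret C: comm_group ?C by (rule comm_group_tensor_power)
  have zero: "tensor [\<zero>, y] = \<one>\<^bsub>?C\<^esub>" "tensor [y, \<zero>] = \<one>\<^bsub>?C\<^esub>" if "y \<in> carrier A" for y
    using that tensor_zero[of "[]" "[y]" 2] tensor_zero[of "[y]" "[]" 2] by simp_all
  have right: "tensor [x, finsum A g J] = finprod ?C (\<lambda>j. tensor [x, g j]) J"
    if x: "x \<in> carrier A" for x
    using assms(2,4)
  proof (induction J rule: finite_induct)
    case (insert j J)
    then have "g \<in> J \<rightarrow> carrier A" "g j \<in> carrier A" by auto
    with insert x show ?case
      by (subst finsum_insert) (simp_all add: tensor2_add_right tensor2_closed Pi_iff)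
  qed (simp add: zero x)
  have gJ: "finsum A g J \<in> carrier A"
    using assms(4) by (intro finsum_closed) auto
  show ?thesis
    using assms(1,3)
  proof (induction I rule: finite_induct)
    case (insert i I)
    then have fI: "f \<in> I \<rightarrow> carrier A" and fi: "f i \<in> carrier A" by auto
    have "tensor [finsum A f (insert i I), finsum A g J] =
        tensor [f i, finsum A g J] \<otimes>\<^bsub>?C\<^esub> tensor [finsum A f I, finsum A g J]"
      using insert fI fi gJ by (subst finsum_insert) (simp_all add: tensor2_add_left)
    \<comment> \<open>The summand for the new index \<open>i\<close> is the row \<open>{i}\<close>
      times \<open>J\<close> of the index rectangle.\<close>
    also have "tensor [f i, finsum A g J] = finprod ?C (\<lambda>(i, j). tensor [f i, g j]) (Pair i ` J)"
      using fi assms(4) by (subst C.finprod_reindex) (auto simp: right inj_on_def tensor2_closed)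
    also have "tensor [finsum A f I, finsum A g J] =
        finprod ?C (\<lambda>(i, j). tensor [f i, g j]) (I \<times> J)"
      using insert by simp
    also have "finprod ?C (\<lambda>(i, j). tensor [f i, g j]) (Pair i ` J) \<otimes>\<^bsub>?C\<^esub>
        finprod ?C (\<lambda>(i, j). tensor [f i, g j]) (I \<times> J) =
        finprod ?C (\<lambda>(i, j). tensor [f i, g j]) (Pair i ` J \<union> I \<times> J)"
      using insert fi assms(2,4) by (intro C.finprod_Un_disjoint[symmetric]) (auto simp: tensor2_closed)
    also have "Pair i ` J \<union> I \<times> J = insert i I \<times> J"
      by auto
    finally show ?case .
  qed (simp add: zero gJ)
qed

text \<open>The \<open>P i\<close> are \<open>B\<close>-bilinear and add up to the identity of
  \<open>A\<close>. By \<open>GP\<close>, \<open>G i j\<close> undoes multiplication on products of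
  an \<open>i\<close>-component with a \<open>j\<close>-component. So \<open>P i\<close> tensor
  \<open>P j\<close> factors through \<open>A\<close>, and the sum of these maps over all pairs is
  the identity of the two-factor power.\<close>

lemma depth_three:
  fixes P :: "'i \<Rightarrow> 'a \<Rightarrow> 'a" and G :: "'i \<Rightarrow> 'i \<Rightarrow> 'a \<Rightarrow> ('a list \<Rightarrow>\<^sub>0 int) set"
  assumes I: "finite I" "I \<noteq> {}"
    and P: "\<And>i x. i \<in> I \<Longrightarrow> x \<in> carrier A \<Longrightarrow> P i x \<in> carrier A"
      "\<And>i x y. i \<in> I \<Longrightarrow> x \<in> carrier A \<Longrightarrow> y \<in> carrier A \<Longrightarrow> P i (x \<oplus> y) = P i x \<oplus> P i y"
      "\<And>i b x. i \<in> I \<Longrightarrow> b \<in> B \<Longrightarrow> x \<in> carrier A \<Longrightarrow> P i (b \<otimes> x) = b \<otimes> P i x"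
      "\<And>i b x. i \<in> I \<Longrightarrow> b \<in> B \<Longrightarrow> x \<in> carrier A \<Longrightarrow> P i (x \<otimes> b) = P i x \<otimes> b"
      "\<And>x. x \<in> carrier A \<Longrightarrow> finsum A (\<lambda>i. P i x) I = x"
    and G: "\<And>i j x. i \<in> I \<Longrightarrow> j \<in> I \<Longrightarrow> x \<in> carrier A \<Longrightarrow> G i j x \<in> carrier (tensor_power A B 2)"
      "\<And>i j x y. i \<in> I \<Longrightarrow> j \<in> I \<Longrightarrow> x \<in> carrier A \<Longrightarrow> y \<in> carrier A \<Longrightarrow>
        G i j (x \<oplus> y) = G i j x \<otimes>\<^bsub>tensor_power A B 2\<^esub> G i j y"
      "\<And>i j b x. i \<in> I \<Longrightarrow> j \<in> I \<Longrightarrow> b \<in> B \<Longrightarrow> x \<in> carrier A \<Longrightarrow>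
        G i j (b \<otimes> x) = lact (tensor_power A B 2) b (G i j x)"
      "\<And>i j b x. i \<in> I \<Longrightarrow> j \<in> I \<Longrightarrow> b \<in> B \<Longrightarrow> x \<in> carrier A \<Longrightarrow>
        G i j (x \<otimes> b) = ract (tensor_power A B 2) (G i j x) b"
    and GP: "\<And>i j x y. i \<in> I \<Longrightarrow> j \<in> I \<Longrightarrow> x \<in> carrier A \<Longrightarrow> y \<in> carrier A \<Longrightarrow>
        G i j (P i x \<otimes> P j y) = tensor [P i x, P j y]"
  shows "C_similar A B (A\<lparr>carrier := B\<rparr>) (A\<lparr>carrier := B\<rparr>) 1"
proof -
  let ?B = "A\<lparr>carrier := B\<rparr>" and ?C1 = "tensor_power A B 1" and ?C2 = "tensor_power A B 2"
  have C1: "bimodule ?B ?B ?C1" and C2: "bimodule ?B ?B ?C2"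
    by (rule bimodule_tensor; simp)+
  interpret C1: bimodule ?B ?B ?C1 by fact
  interpret C2: bimodule ?B ?B ?C2 by fact
  have BB: "scalar_ring ?B" by simp
  have "bimod_divides ?B ?B ?C1 (copies 1 ?C2)"
    unfolding bimod_divides_copies_iff[OF C1 C2]
  proof -
    obtain f where f: "f \<in> bimod_hom ?B ?B ?C1 ?C2"
      "\<And>x. x \<in> carrier A \<Longrightarrow> f (tensor [x]) = tensor [x, \<one>]"
    proof (rule tensor1_hom_exists[OF BB BB C2, of "\<lambda>x. tensor [x, \<one>]"])
      \<comment> \<open>Inserting 1 on the right is compatible with the right action of
        \<open>B\<close> by balancing: \<open>x s\<close> tensor 1 equals \<open>x\<close> tensor
        \<open>s\<close>.\<close>
      show "tensor [x \<otimes> s, \<one>] = ract ?C2 (tensor [x, \<one>]) s"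
        if "s \<in> carrier ?B" "x \<in> carrier A" for s x
        using that subset by (simp add: tensor2_ract tensor2_balanced)
    qed (simp_all add: tensor2_closed tensor2_add_left tensor2_lact subset)
    obtain g where g: "g \<in> bimod_hom ?B ?B ?C2 ?C1"
      "\<And>x y. x \<in> carrier A \<Longrightarrow> y \<in> carrier A \<Longrightarrow> g (tensor [x, y]) = tensor [x \<otimes> y]"
      by (rule tensor2_hom_exists[OF BB BB C1, of "\<lambda>x y. tensor [x \<otimes> y]"])
        (simp_all add: tensor1_closed tensor1_add tensor1_lact tensor1_ract subset l_distr r_distr m_assoc
          del: One_nat_def)
    have "finprod ?C1 (\<lambda>_. g (f x)) {..<1::nat} = x" if "x \<in> carrier ?C1" for x
    proof -
      obtain y where y: "y \<in> carrier A" "x = tensor [y]"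
        using \<open>x \<in> carrier ?C1\<close> by (rule tensor1_cases)
      have "finprod ?C1 (\<lambda>_. g (f x)) {..<1::nat} = g (f x) [^]\<^bsub>?C1\<^esub> (1::nat)"
        using C1.M.finprod_const[OF bimod_hom_closed[OF g(1) bimod_hom_closed[OF f(1) that]], of "{..<1::nat}"]
        by (simp only: card_lessThan)
      also have "\<dots> = g (f x)"
        using bimod_hom_closed[OF g(1) bimod_hom_closed[OF f(1) that]] by (rule C1.M.nat_pow_eone)
      also have "\<dots> = x"
        unfolding y(2) by (simp only: f(2)[OF y(1)] g(2)[OF y(1) one_closed] r_one[OF y(1)])
      finally show ?thesis .
    qed
    then show "\<exists>p q. (\<forall>i<1. p i \<in> bimod_hom ?B ?B ?C1 ?C2 \<and> q i \<in> bimod_hom ?B ?B ?C2 ?C1) \<and>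
        (\<forall>x\<in>carrier ?C1. finprod ?C1 (\<lambda>i::nat. q i (p i x)) {..<1} = x)"
      using f(1) g(1) by (intro exI[of _ "\<lambda>_. f"] exI[of _ "\<lambda>_. g"] conjI allI impI ballI)
  qed
  moreover have "bimod_divides ?B ?B ?C2 (copies (card (I \<times> I)) ?C1)"
    unfolding bimod_divides_copies_iff[OF C2 C1]
  proof -
    have "\<forall>k\<in>I \<times> I. \<exists>f. f \<in> bimod_hom ?B ?B ?C2 ?C1 \<and>
        (\<forall>x\<in>carrier A. \<forall>y\<in>carrier A. f (tensor [x, y]) = tensor [P (fst k) x \<otimes> P (snd k) y])"
    proof
      fix k assume "k \<in> I \<times> I"
      then have k: "fst k \<in> I" "snd k \<in> I" by auto
      obtain f where "f \<in> bimod_hom ?B ?B ?C2 ?C1"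
        "\<And>x y. x \<in> carrier A \<Longrightarrow> y \<in> carrier A \<Longrightarrow> f (tensor [x, y]) = tensor [P (fst k) x \<otimes> P (snd k) y]"
        by (rule tensor2_hom_exists[OF BB BB C1, of "\<lambda>x y. tensor [P (fst k) x \<otimes> P (snd k) y]"])
          (simp_all add: k P tensor1_closed tensor1_add tensor1_lact tensor1_ract subset l_distr r_distr
            m_assoc del: One_nat_def)
      then show "\<exists>f. f \<in> bimod_hom ?B ?B ?C2 ?C1 \<and>
        (\<forall>x\<in>carrier A. \<forall>y\<in>carrier A. f (tensor [x, y]) = tensor [P (fst k) x \<otimes> P (snd k) y])"
        by (intro exI[of _ f] conjI ballI)
    qed
    \<comment> \<open>The universal property yields a map for each pair separately; here the maps
      for all pairs are chosen at once.\<close>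
    from bchoice[OF this] obtain f where *: "\<forall>k\<in>I \<times> I. f k \<in> bimod_hom ?B ?B ?C2 ?C1 \<and>
        (\<forall>x\<in>carrier A. \<forall>y\<in>carrier A. f k (tensor [x, y]) = tensor [P (fst k) x \<otimes> P (snd k) y])" ..
    have f: "f k \<in> bimod_hom ?B ?B ?C2 ?C1" if "k \<in> I \<times> I" for k
      using bspec[OF * that] by (rule conjunct1)
    have fx: "f k (tensor [x, y]) = tensor [P (fst k) x \<otimes> P (snd k) y]"
      if "k \<in> I \<times> I" "x \<in> carrier A" "y \<in> carrier A" for k x y
      by (rule bspec[OF bspec[OF conjunct2[OF bspec[OF * that(1)]] that(2)] that(3)])
    have "\<forall>k\<in>I \<times> I. \<exists>g. g \<in> bimod_hom ?B ?B ?C1 ?C2 \<and>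
        (\<forall>x\<in>carrier A. g (tensor [x]) = G (fst k) (snd k) x)"
    proof
      fix k assume "k \<in> I \<times> I"
      then have k: "fst k \<in> I" "snd k \<in> I" by auto
      obtain g where "g \<in> bimod_hom ?B ?B ?C1 ?C2"
        "\<And>x. x \<in> carrier A \<Longrightarrow> g (tensor [x]) = G (fst k) (snd k) x"
        by (rule tensor1_hom_exists[OF BB BB C2, of "G (fst k) (snd k)"]) (simp_all add: k G)
      then show "\<exists>g. g \<in> bimod_hom ?B ?B ?C1 ?C2 \<and>
        (\<forall>x\<in>carrier A. g (tensor [x]) = G (fst k) (snd k) x)"
        by (intro exI[of _ g] conjI ballI)
    qed
    from bchoice[OF this] obtain g where **: "\<forall>k\<in>I \<times> I. g k \<in> bimod_hom ?B ?B ?C1 ?C2 \<and>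
        (\<forall>x\<in>carrier A. g k (tensor [x]) = G (fst k) (snd k) x)" ..
    have g: "g k \<in> bimod_hom ?B ?B ?C1 ?C2" if "k \<in> I \<times> I" for k
      using bspec[OF ** that] by (rule conjunct1)
    have gx: "g k (tensor [x]) = G (fst k) (snd k) x" if "k \<in> I \<times> I" "x \<in> carrier A" for k x
      by (rule bspec[OF conjunct2[OF bspec[OF ** that(1)]] that(2)])
    have gf: "g k (f k x) \<in> carrier ?C2" if "k \<in> I \<times> I" "x \<in> carrier ?C2" for k x
      using bimod_hom_closed[OF g[OF that(1)] bimod_hom_closed[OF f[OF that(1)] that(2)]] .
    \<comment> \<open>On a pure tensor this is the biadditive expansion of both factors into their
      components.\<close>
    have sum: "finprod ?C2 (\<lambda>k. g k (f k x)) (I \<times> I) = x" if x: "x \<in> carrier ?C2" for x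
    proof (rule tensor_power_hom_eqI[OF C2.comm_group_axioms _ _ _ _ x])
      show "(\<lambda>x. finprod ?C2 (\<lambda>k. g k (f k x)) (I \<times> I)) \<in> hom ?C2 ?C2"
      proof (rule homI)
        fix x y assume x: "x \<in> carrier ?C2" and y: "y \<in> carrier ?C2"
        show "finprod ?C2 (\<lambda>k. g k (f k x)) (I \<times> I) \<in> carrier ?C2"
          by (intro C2.M.finprod_closed Pi_I gf x)
        have "finprod ?C2 (\<lambda>k. g k (f k (x \<otimes>\<^bsub>?C2\<^esub> y))) (I \<times> I) =
            finprod ?C2 (\<lambda>k. g k (f k x) \<otimes>\<^bsub>?C2\<^esub> g k (f k y)) (I \<times> I)"
        proof (rule C2.finprod_cong')
          show "(\<lambda>k. g k (f k x) \<otimes>\<^bsub>?C2\<^esub> g k (f k y)) \<in> I \<times> I \<rightarrow> carrier ?C2"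
            by (intro Pi_I C2.M.m_closed gf x y)
          show "g k (f k (x \<otimes>\<^bsub>?C2\<^esub> y)) = g k (f k x) \<otimes>\<^bsub>?C2\<^esub> g k (f k y)" if "k \<in> I \<times> I" for k
            using bimod_hom_add[OF f[OF that] x y]
              bimod_hom_add[OF g[OF that] bimod_hom_closed[OF f[OF that] x] bimod_hom_closed[OF f[OF that] y]]
            by simp
        qed simp
        also have "\<dots> = finprod ?C2 (\<lambda>k. g k (f k x)) (I \<times> I) \<otimes>\<^bsub>?C2\<^esub> finprod ?C2 (\<lambda>k. g k (f k y)) (I \<times> I)"
          by (intro C2.M.finprod_multf Pi_I gf x y)
        finally show "finprod ?C2 (\<lambda>k. g k (f k (x \<otimes>\<^bsub>?C2\<^esub> y))) (I \<times> I) =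
          finprod ?C2 (\<lambda>k. g k (f k x)) (I \<times> I) \<otimes>\<^bsub>?C2\<^esub> finprod ?C2 (\<lambda>k. g k (f k y)) (I \<times> I)" .
      qed
      show "(\<lambda>x. x) \<in> hom ?C2 ?C2" by (rule homI) simp_all
      fix as assume "as \<in> lists (carrier A)" "length as = 2"
      then obtain x y where as: "as = [x, y]" and x: "x \<in> carrier A" and y: "y \<in> carrier A"
        by (rule list2_cases)
      have "finprod ?C2 (\<lambda>k. g k (f k (tensor [x, y]))) (I \<times> I) =
          finprod ?C2 (\<lambda>(i, j). tensor [P i x, P j y]) (I \<times> I)"
      proof (rule C2.finprod_cong')
        show "(\<lambda>(i, j). tensor [P i x, P j y]) \<in> I \<times> I \<rightarrow> carrier ?C2"
          using x y by (auto simp: P tensor2_closed)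
        show "g k (f k (tensor [x, y])) = (case k of (i, j) \<Rightarrow> tensor [P i x, P j y])" if "k \<in> I \<times> I" for k
          using that x y by (auto simp: fx gx GP P)
      qed simp
      also have "\<dots> = tensor [finsum A (\<lambda>i. P i x) I, finsum A (\<lambda>i. P i y) I]"
        using x y I by (intro tensor2_finsum[symmetric]) (auto simp: P)
      also have "\<dots> = tensor as"
        using x y by (simp add: as P)
      finally show "finprod ?C2 (\<lambda>k. g k (f k (tensor as))) (I \<times> I) = tensor as"
        by (simp add: as)
    qed simp
    \<comment> \<open>Copies are indexed by an initial segment of the naturals, so the pairs are
      renumbered.\<close>
    obtain e where e: "bij_betw e {..<card (I \<times> I)} (I \<times> I)"
      using ex_bij_betw_nat_finite[of "I \<times> I"] I by (auto simp: atLeast0LessThan)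
    have ek: "e t \<in> I \<times> I" if "t < card (I \<times> I)" for t
      using e that by (auto simp: bij_betw_def)
    have "finprod ?C2 (\<lambda>t. g (e t) (f (e t) x)) {..<card (I \<times> I)} = x" if x: "x \<in> carrier ?C2" for x
    proof -
      have im: "e ` {..<card (I \<times> I)} = I \<times> I" and inj: "inj_on e {..<card (I \<times> I)}"
        using e by (auto simp: bij_betw_def)
      have "finprod ?C2 (\<lambda>k. g k (f k x)) (e ` {..<card (I \<times> I)}) =
          finprod ?C2 (\<lambda>t. g (e t) (f (e t) x)) {..<card (I \<times> I)}"
      proof (rule C2.M.finprod_reindex)
        show "(\<lambda>k. g k (f k x)) \<in> e ` {..<card (I \<times> I)} \<rightarrow> carrier ?C2"
          unfolding im by (intro Pi_I gf x)
      qed (rule inj)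
      then show ?thesis
        unfolding im using sum[OF x] by simp
    qed
    then show "\<exists>p q. (\<forall>i<card (I \<times> I). p i \<in> bimod_hom ?B ?B ?C2 ?C1 \<and> q i \<in> bimod_hom ?B ?B ?C1 ?C2) \<and>
        (\<forall>x\<in>carrier ?C2. finprod ?C2 (\<lambda>i. q i (p i x)) {..<card (I \<times> I)} = x)"
      using f[OF ek] g[OF ek]
      by (intro exI[of _ "\<lambda>t. f (e t)"] exI[of _ "\<lambda>t. g (e t)"] conjI allI impI ballI)
  qed
  \<comment> \<open>\<open>H_equivalent\<close> demands at least one copy, hence the nonempty index
    set.\<close>
  moreover have "card (I \<times> I) \<ge> 1"
    using I by (simp add: Suc_le_eq card_gt_0_iff)
  ultimately have "H_equivalent ?B ?B ?C2 ?C1"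
    unfolding H_equivalent_def by blast
  then show ?thesis
    by (simp add: C_similar_def numeral_2_eq_2)
qed

end


section \<open>Path algebras\<close>

lemma poly_mapping_decompose:
  "f = (\<Sum>x\<in>Poly_Mapping.keys f. Poly_Mapping.single x (Poly_Mapping.lookup f x))"
  by (rule poly_mapping_eqI) (simp add: lookup_sum lookup_single when_def in_keys_iff)

lemma poly_mapping_single_add_induct [case_names single add]:
  assumes "\<And>x c. P (Poly_Mapping.single x c)" "\<And>f g. P f \<Longrightarrow> P g \<Longrightarrow> P (f + g)"
  shows "P (f :: 'a \<Rightarrow>\<^sub>0 'b::comm_monoid_add)"
proof -
  \<comment> \<open>The empty sum is covered by the single term with coefficient 0, at an arbitrary
    position.\<close>
  have "P (\<Sum>x\<in>I. Poly_Mapping.single x (Poly_Mapping.lookup f x))" for I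
    by (induction I rule: infinite_finite_induct)
      (use assms(1)[of undefined 0] in \<open>simp_all add: assms\<close>)
  then show ?thesis
    using poly_mapping_decompose[of f] by metis
qed

text \<open>The summand of \<open>path_mult\<close>, with projections in place of tuple patterns, so
  that it can be summed over any finite sets of paths and is visibly additive in the
  coefficient.\<close>

definition path_term ::
  "('v, 'e) path \<Rightarrow> ('v, 'e) path \<Rightarrow> 'k::field \<Rightarrow> (('v, 'e) path \<Rightarrow>\<^sub>0 'k)"
where
  "path_term x y k = (if snd (snd x) = fst y
     then Poly_Mapping.single (fst x, fst (snd x) @ fst (snd y), snd (snd y)) k else 0)"

lemma path_term_add: "path_term x y (k + l) = path_term x y k + path_term x y l"
  by (simp add: path_term_def single_add)

lemma path_term_zero [simp]: "path_term x y 0 = 0"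
  by (simp add: path_term_def)

text \<open>Enlarging the supports adds only zero terms. With a common index set for two summands,
  distributivity becomes termwise.\<close>

lemma path_mult_eq_sum:
  assumes "finite S" "finite T" "Poly_Mapping.keys f \<subseteq> S" "Poly_Mapping.keys g \<subseteq> T"
  shows "path_mult f g =
    (\<Sum>x\<in>S. \<Sum>y\<in>T. path_term x y (Poly_Mapping.lookup f x * Poly_Mapping.lookup g y))"
proof -
  have "path_mult f g = (\<Sum>x\<in>Poly_Mapping.keys f. \<Sum>y\<in>Poly_Mapping.keys g.
      path_term x y (Poly_Mapping.lookup f x * Poly_Mapping.lookup g y))"
    unfolding path_mult_def path_term_def by (intro sum.cong refl) (auto intro!: sum.cong)
  also have "\<dots> = (\<Sum>x\<in>S. \<Sum>y\<in>Poly_Mapping.keys g.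
      path_term x y (Poly_Mapping.lookup f x * Poly_Mapping.lookup g y))"
    using assms by (intro sum.mono_neutral_left) (auto simp: in_keys_iff)
  also have "\<dots> = (\<Sum>x\<in>S. \<Sum>y\<in>T. path_term x y (Poly_Mapping.lookup f x * Poly_Mapping.lookup g y))"
    using assms by (intro sum.cong sum.mono_neutral_left) (auto simp: in_keys_iff)
  finally show ?thesis .
qed

lemma path_mult_add_left: "path_mult (f + f') g = path_mult f g + path_mult f' g"
proof -
  let ?S = "Poly_Mapping.keys f \<union> Poly_Mapping.keys f'"
  show ?thesis
    using keys_add[of f f']
    by (simp add: path_mult_eq_sum[of ?S "Poly_Mapping.keys g"] lookup_add distrib_right
        path_term_add sum.distrib)
qed

lemma path_mult_add_right: "path_mult f (g + g') = path_mult f g + path_mult f g'"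
proof -
  let ?S = "Poly_Mapping.keys g \<union> Poly_Mapping.keys g'"
  show ?thesis
    using keys_add[of g g']
    by (simp add: path_mult_eq_sum[of "Poly_Mapping.keys f" ?S] lookup_add distrib_left
        path_term_add sum.distrib)
qed

lemma path_mult_zero [simp]: "path_mult 0 g = 0" "path_mult f 0 = 0"
  by (simp_all add: path_mult_def case_prod_unfold)

lemma path_mult_sum_left: "path_mult (\<Sum>i\<in>I. f i) g = (\<Sum>i\<in>I. path_mult (f i) g)"
  by (induction I rule: infinite_finite_induct) (simp_all add: path_mult_add_left)

lemma path_mult_sum_right: "path_mult g (\<Sum>i\<in>I. f i) = (\<Sum>i\<in>I. path_mult g (f i))"
  by (induction I rule: infinite_finite_induct) (simp_all add: path_mult_add_right)

lemma path_mult_single: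
  "path_mult (Poly_Mapping.single x k) (Poly_Mapping.single y l) = path_term x y (k * l)"
  using path_mult_eq_sum[of "{x}" "{y}" "Poly_Mapping.single x k" "Poly_Mapping.single y l"]
  by simp

lemma path_mult_assoc: "path_mult (path_mult f g) h = path_mult f (path_mult g h)"
proof (induction f rule: poly_mapping_single_add_induct)
  case (single x k)
  show ?case
  proof (induction g rule: poly_mapping_single_add_induct)
    case (single y l)
    show ?case
    proof (induction h rule: poly_mapping_single_add_induct)
      case (single z m)
      show ?case
        by (simp add: path_mult_single path_term_def mult.assoc)
    qed (simp add: path_mult_add_right)
  qed (simp add: path_mult_add_right path_mult_add_left)
qed (simp add: path_mult_add_left)

lemma keys_path_mult:
  assumes "z \<in> Poly_Mapping.keys (path_mult f g)"
  obtains a p b q d where "z = (a, p @ q, d)" "(a, p, b) \<in> Poly_Mapping.keys f"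
    "(b, q, d) \<in> Poly_Mapping.keys g"
proof -
  have "z \<in> Poly_Mapping.keys (\<Sum>x\<in>Poly_Mapping.keys f. \<Sum>y\<in>Poly_Mapping.keys g.
      path_term x y (Poly_Mapping.lookup f x * Poly_Mapping.lookup g y))"
    using assms by (simp add: path_mult_eq_sum[OF finite_keys finite_keys order_refl order_refl])
  from subsetD[OF keys_sum this] obtain x where x: "x \<in> Poly_Mapping.keys f"
    "z \<in> Poly_Mapping.keys (\<Sum>y\<in>Poly_Mapping.keys g.
      path_term x y (Poly_Mapping.lookup f x * Poly_Mapping.lookup g y))"
    by (rule UN_E)
  from subsetD[OF keys_sum x(2)] obtain y where y: "y \<in> Poly_Mapping.keys g"
    "z \<in> Poly_Mapping.keys (path_term x y (Poly_Mapping.lookup f x * Poly_Mapping.lookup g y))"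
    by (rule UN_E)
  moreover obtain a p b where "x = (a, p, b)" by (rule prod_cases3)
  moreover obtain b' q d where "y = (b', q, d)" by (rule prod_cases3)
  ultimately show thesis
    using x(1) that[of a p q d b] by (auto simp: path_term_def split: if_splits)
qed

text \<open>Without arcs the symmetrized graph has none either, so each vertex reaches only itself;
  this contradicts two distinct vertices.\<close>

lemma connected_arcs_nonempty:
  assumes "fin_digraph Q" "connected Q" "card (verts Q) > 1"
  shows "arcs Q \<noteq> {}"
proof
  assume empty: "arcs Q = {}"
  obtain a b where ab: "a \<in> verts Q" "b \<in> verts Q" "a \<noteq> b"
    using assms(3) by (metis One_nat_def card_le_Suc0_iff_eq card.infinite leD less_nat_zero_code)
  have "a \<rightarrow>\<^sup>*\<^bsub>with_proj (mk_symmetric Q)\<^esub> b"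
    using assms(2) ab by (simp add: connected_def strongly_connected_def)
  then have "(a, b) \<in> rtrancl_on (verts Q) {}"
    using empty by (simp add: reachable_def mk_symmetric_def arcs_ends_def)
  then show False
    using ab(3) by (induction rule: rtrancl_on_induct) auto
qed

lemma path_algebra_simps [simp]:
  "carrier (path_algebra Q) = {f. Poly_Mapping.keys f \<subseteq> paths Q}"
  "monoid.mult (path_algebra Q) = path_mult"
  "\<one>\<^bsub>path_algebra Q\<^esub> = (\<Sum>a\<in>verts Q. stationary a)"
  "\<zero>\<^bsub>path_algebra Q\<^esub> = 0"
  "add (path_algebra Q) = (+)"
  by (simp_all add: path_algebra_def)

text \<open>A diagonal matrix given by its entries. The unit is the constant function 1, field
  scalars are the constants, and vertex idempotents are indicator functions, so computations in the
  top subalgebra become computations with \<open>c\<close>.\<close>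

definition diagonal :: "('v, 'e) pre_digraph \<Rightarrow> ('v \<Rightarrow> 'k::field) \<Rightarrow> (('v, 'e) path \<Rightarrow>\<^sub>0 'k)"
  where "diagonal Q c = (\<Sum>a\<in>verts Q. Poly_Mapping.single (a, [], a) (c a))"

lemma top_subalgebra_eq: "top_subalgebra Q = range (diagonal Q)"
  by (auto simp: top_subalgebra_def diagonal_def)

lemma one_eq_diagonal: "(\<Sum>a\<in>verts Q. stationary a) = diagonal Q (\<lambda>_. 1)"
  by (simp add: diagonal_def stationary_def)

locale quiver = fin_digraph Q for Q :: "('v, 'e) pre_digraph"
begin

lemma lookup_diagonal:
  "Poly_Mapping.lookup (diagonal Q c) (a, p, b) = (if p = [] \<and> a = b \<and> a \<in> verts Q then c a else 0)"
proof -
  have "Poly_Mapping.lookup (diagonal Q c) (a, p, b) =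
      (\<Sum>v\<in>verts Q. if v = a then (if p = [] \<and> a = b then c a else 0) else 0)"
    unfolding diagonal_def lookup_sum by (intro sum.cong) (auto simp: lookup_single when_def)
  then show ?thesis by auto
qed

lemma path_ends_in_verts:
  assumes "(a, p, b) \<in> paths Q"
  shows "a \<in> verts Q" "b \<in> verts Q"
  using assms awalk_hd_in_verts awalk_last_in_verts by (auto simp: paths_def)

lemma lookup_not_path:
  assumes "Poly_Mapping.keys f \<subseteq> paths Q" "x \<notin> paths Q"
  shows "Poly_Mapping.lookup f x = 0"
  using assms by (auto simp: in_keys_iff)

text \<open>A path is an eigenvector of left multiplication by a diagonal element, with eigenvalue
  the entry at its start; on the right it is the entry at its end.\<close>

lemma lookup_diagonal_mult:
  assumes "Poly_Mapping.keys f \<subseteq> paths Q"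
  shows "Poly_Mapping.lookup (path_mult (diagonal Q c) f) (a, p, b) = c a * Poly_Mapping.lookup f (a, p, b)"
proof -
  \<comment> \<open>The induction passes through functions not supported on paths, so
    \<open>c\<close> is first cut off outside the vertices. For \<open>f\<close> in the algebra the
    cutoff has no effect.\<close>
  have "Poly_Mapping.lookup (path_mult (diagonal Q c) f) (a, p, b) =
      (if a \<in> verts Q then c a else 0) * Poly_Mapping.lookup f (a, p, b)" for f
  proof (induction f rule: poly_mapping_single_add_induct)
    case (single x k)
    obtain a' p' b' where x: "x = (a', p', b')" by (rule prod_cases3)
    have "Poly_Mapping.lookup (path_mult (diagonal Q c) (Poly_Mapping.single x k)) (a, p, b) =
        (\<Sum>v\<in>verts Q. if v = a then (c a * k when x = (a, p, b)) else 0)"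
      unfolding diagonal_def path_mult_sum_left lookup_sum
      by (intro sum.cong) (auto simp: x path_mult_single path_term_def lookup_single when_def)
    then show ?case
      by (simp add: lookup_single when_def)
  qed (simp add: path_mult_add_right lookup_add distrib_left)
  then show ?thesis
    using lookup_not_path[OF assms, of "(a, p, b)"] path_ends_in_verts(1)[of a p b] by auto
qed

lemma lookup_mult_diagonal:
  assumes "Poly_Mapping.keys f \<subseteq> paths Q"
  shows "Poly_Mapping.lookup (path_mult f (diagonal Q c)) (a, p, b) = Poly_Mapping.lookup f (a, p, b) * c b"
proof -
  have "Poly_Mapping.lookup (path_mult f (diagonal Q c)) (a, p, b) =
      Poly_Mapping.lookup f (a, p, b) * (if b \<in> verts Q then c b else 0)" for f
  proof (induction f rule: poly_mapping_single_add_induct)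
    case (single x k)
    obtain a' p' b' where x: "x = (a', p', b')" by (rule prod_cases3)
    have "Poly_Mapping.lookup (path_mult (Poly_Mapping.single x k) (diagonal Q c)) (a, p, b) =
        (\<Sum>v\<in>verts Q. if v = b then (k * c b when x = (a, p, b)) else 0)"
      unfolding diagonal_def path_mult_sum_right lookup_sum
      by (intro sum.cong) (auto simp: x path_mult_single path_term_def lookup_single when_def)
    then show ?case
      by (simp add: lookup_single when_def)
  qed (simp add: path_mult_add_left lookup_add distrib_right)
  then show ?thesis
    using lookup_not_path[OF assms, of "(a, p, b)"] path_ends_in_verts(2)[of a p b] by auto
qed

lemma keys_diagonal: "Poly_Mapping.keys (diagonal Q c) \<subseteq> paths Q"
proof
  fix x assume "x \<in> Poly_Mapping.keys (diagonal Q c)"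
  then show "x \<in> paths Q"
    by (cases x) (auto simp: in_keys_iff lookup_diagonal paths_def awalk_Nil_iff split: if_splits)
qed

lemma keys_path_mult_paths:
  assumes "Poly_Mapping.keys f \<subseteq> paths Q" "Poly_Mapping.keys g \<subseteq> paths Q"
  shows "Poly_Mapping.keys (path_mult f g) \<subseteq> paths Q"
proof
  fix x assume "x \<in> Poly_Mapping.keys (path_mult f g)"
  then obtain a p b q d where "x = (a, p @ q, d)" "(a, p, b) \<in> Poly_Mapping.keys f"
    "(b, q, d) \<in> Poly_Mapping.keys g"
    by (rule keys_path_mult)
  with assms have "awalk a p b" "awalk b q d"
    by (auto simp: paths_def)
  then show "x \<in> paths Q"
    using awalk_appendI[of a p b q d] \<open>x = (a, p @ q, d)\<close> by (simp add: paths_def)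
qed

lemma ring_path_algebra: "ring (path_algebra Q :: (('v, 'e) path \<Rightarrow>\<^sub>0 'k::field) ring)"
proof (rule ringI)
  let ?A = "path_algebra Q :: (('v, 'e) path \<Rightarrow>\<^sub>0 'k) ring"
  show "abelian_group ?A"
  proof (rule abelian_groupI)
    fix f assume f: "f \<in> carrier ?A"
    then show "\<exists>g\<in>carrier ?A. g \<oplus>\<^bsub>?A\<^esub> f = \<zero>\<^bsub>?A\<^esub>"
      by (intro bexI[of _ "- f"]) simp_all
  next
    fix f g assume "f \<in> carrier ?A" "g \<in> carrier ?A"
    then show "f \<oplus>\<^bsub>?A\<^esub> g \<in> carrier ?A"
      using order_trans[OF keys_add[of f g] Un_least, of "paths Q"] by simp
  qed (simp_all add: add_ac)
  show "monoid ?A"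
  proof (rule monoidI)
    fix f assume f: "f \<in> carrier ?A"
    show "\<one>\<^bsub>?A\<^esub> \<otimes>\<^bsub>?A\<^esub> f = f" "f \<otimes>\<^bsub>?A\<^esub> \<one>\<^bsub>?A\<^esub> = f"
      using f by (auto intro!: poly_mapping_eqI simp: one_eq_diagonal lookup_diagonal_mult lookup_mult_diagonal)
  qed (use keys_path_mult_paths keys_diagonal in \<open>simp_all add: path_mult_assoc one_eq_diagonal\<close>)
qed (simp_all add: path_mult_add_left path_mult_add_right)

lemma diagonal_mult_diagonal: "path_mult (diagonal Q c) (diagonal Q d) = diagonal Q (\<lambda>a. c a * d a)"
  by (rule poly_mapping_eqI) (auto simp: lookup_diagonal_mult[OF keys_diagonal] lookup_diagonal)

lemma subring_top: "subring (top_subalgebra Q) (path_algebra Q :: (('v, 'e) path \<Rightarrow>\<^sub>0 'k::field) ring)"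
proof -
  let ?A = "path_algebra Q :: (('v, 'e) path \<Rightarrow>\<^sub>0 'k) ring"
  interpret A: ring ?A by (rule ring_path_algebra)
  have minus: "\<ominus>\<^bsub>?A\<^esub> diagonal Q c = diagonal Q (\<lambda>a. - c a)" for c
  proof (rule A.minus_equality)
    show "diagonal Q (\<lambda>a. - c a) \<oplus>\<^bsub>?A\<^esub> diagonal Q c = \<zero>\<^bsub>?A\<^esub>"
      by (simp add: diagonal_def flip: sum.distrib single_add)
  qed (simp_all add: keys_diagonal)
  show ?thesis
  proof (rule A.subringI)
    show "top_subalgebra Q \<subseteq> carrier ?A"
      using keys_diagonal by (auto simp: top_subalgebra_eq)
    show "\<one>\<^bsub>?A\<^esub> \<in> top_subalgebra Q"
      by (simp add: one_eq_diagonal top_subalgebra_eq)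
    show "\<ominus>\<^bsub>?A\<^esub> h \<in> top_subalgebra Q" if "h \<in> top_subalgebra Q" for h
      using that by (auto simp: top_subalgebra_eq minus)
    show "h \<otimes>\<^bsub>?A\<^esub> h' \<in> top_subalgebra Q" "h \<oplus>\<^bsub>?A\<^esub> h' \<in> top_subalgebra Q"
      if "h \<in> top_subalgebra Q" "h' \<in> top_subalgebra Q" for h h'
      using that by (auto simp: top_subalgebra_eq diagonal_mult_diagonal)
        (simp add: diagonal_def flip: sum.distrib single_add)
  qed
qed

lemma ring_extension_path_algebra:
  "ring_extension (path_algebra Q :: (('v, 'e) path \<Rightarrow>\<^sub>0 'k::field) ring) (top_subalgebra Q)"
  by (intro ring_extension.intro ring_extension_axioms.intro ring_path_algebra subring_top)

section \<open>Components along paths and tensors of two paths\<close>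

definition component :: "('v, 'e) path \<Rightarrow> (('v, 'e) path \<Rightarrow>\<^sub>0 'k::field) \<Rightarrow> (('v, 'e) path \<Rightarrow>\<^sub>0 'k)"
  where "component x f = Poly_Mapping.single x (Poly_Mapping.lookup f x)"

lemma keys_single_path: "x \<in> paths Q \<Longrightarrow> Poly_Mapping.keys (Poly_Mapping.single x k) \<subseteq> paths Q"
  by simp

lemma diagonal_mult_single:
  assumes "x \<in> paths Q"
  shows "path_mult (diagonal Q c) (Poly_Mapping.single x k) = Poly_Mapping.single x (c (fst x) * k)"
proof (rule poly_mapping_eqI)
  fix y :: "('v, 'e) path"
  obtain a p b where "y = (a, p, b)" by (rule prod_cases3)
  then show "Poly_Mapping.lookup (path_mult (diagonal Q c) (Poly_Mapping.single x k)) y =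
      Poly_Mapping.lookup (Poly_Mapping.single x (c (fst x) * k)) y"
    by (simp add: lookup_diagonal_mult[OF keys_single_path[OF assms]] lookup_single when_def)
qed

lemma single_mult_diagonal:
  assumes "x \<in> paths Q"
  shows "path_mult (Poly_Mapping.single x k) (diagonal Q c) = Poly_Mapping.single x (k * c (snd (snd x)))"
proof (rule poly_mapping_eqI)
  fix y :: "('v, 'e) path"
  obtain a p b where "y = (a, p, b)" by (rule prod_cases3)
  then show "Poly_Mapping.lookup (path_mult (Poly_Mapping.single x k) (diagonal Q c)) y =
      Poly_Mapping.lookup (Poly_Mapping.single x (k * c (snd (snd x)))) y"
    by (simp add: lookup_mult_diagonal[OF keys_single_path[OF assms]] lookup_single when_def)
qed

lemma component_closed:
  "x \<in> paths Q \<Longrightarrow> Poly_Mapping.keys (component x f) \<subseteq> paths Q"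
  by (simp add: component_def)

lemma component_add: "component x (f + g) = component x f + component x g"
  by (simp add: component_def lookup_add single_add)

text \<open>The top subalgebra acts on the multiples of \<open>x\<close> by scalars from both sides,
  so the coordinate projections are \<open>B\<close>-bilinear, as the \<open>P\<close> of the
  criteria above must be.\<close>

lemma component_mult:
  assumes "x \<in> paths Q" "Poly_Mapping.keys f \<subseteq> paths Q" "b \<in> top_subalgebra Q"
  shows "component x (path_mult b f) = path_mult b (component x f)"
    and "component x (path_mult f b) = path_mult (component x f) b"
proof -
  obtain c where b: "b = diagonal Q c" using assms(3) by (auto simp: top_subalgebra_eq)
  show "component x (path_mult b f) = path_mult b (component x f)"
    unfolding b component_def diagonal_mult_single[OF assms(1)]
    using lookup_diagonal_mult[OF assms(2), of c "fst x" "fst (snd x)" "snd (snd x)"] by simp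
  show "component x (path_mult f b) = path_mult (component x f) b"
    unfolding b component_def single_mult_diagonal[OF assms(1)]
    using lookup_mult_diagonal[OF assms(2), of c "fst x" "fst (snd x)" "snd (snd x)"] by simp
qed

lemma finsum_path_algebra:
  assumes "\<And>i. i \<in> I \<Longrightarrow> Poly_Mapping.keys (f i) \<subseteq> paths Q"
  shows "finsum (path_algebra Q) f I = (\<Sum>i\<in>I. f i :: ('v, 'e) path \<Rightarrow>\<^sub>0 'k::field)"
proof -
  interpret A: ring "path_algebra Q :: (('v, 'e) path \<Rightarrow>\<^sub>0 'k) ring" by (rule ring_path_algebra)
  show ?thesis
    using assms
  proof (induction I rule: infinite_finite_induct)
    case (insert i I)
    then show ?case
      by (subst A.finsum_insert) auto
  qed simp_all
qed

text \<open>The relators do not mention field scalars, but \<open>l\<close> acts as the constant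
  diagonal element, which lies in the top subalgebra and can be moved by balancing.\<close>

lemma tensor_scalar_swap:
  fixes k l :: "'k::field"
  assumes "x \<in> paths Q" "y \<in> paths Q"
  defines "T \<equiv> ring_extension.tensor (path_algebra Q) (top_subalgebra Q)"
  shows "T [Poly_Mapping.single x (k * l), Poly_Mapping.single y 1] =
    T [Poly_Mapping.single x k, Poly_Mapping.single y l]"
proof -
  interpret E: ring_extension "path_algebra Q :: (('v, 'e) path \<Rightarrow>\<^sub>0 'k) ring" "top_subalgebra Q"
    by (rule ring_extension_path_algebra)
  have "T [path_mult (Poly_Mapping.single x k) (diagonal Q (\<lambda>_. l)), Poly_Mapping.single y 1] =
      T [Poly_Mapping.single x k, path_mult (diagonal Q (\<lambda>_. l)) (Poly_Mapping.single y 1)]"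
    using E.tensor2_balanced[of "Poly_Mapping.single x k" "diagonal Q (\<lambda>_. l)" "Poly_Mapping.single y 1"] assms
    by (simp add: top_subalgebra_eq)
  then show ?thesis
    using assms by (simp add: diagonal_mult_single single_mult_diagonal)
qed

text \<open>With \<open>e\<close> the idempotent at the end of \<open>x\<close>, \<open>x\<close>
  tensor \<open>y\<close> equals \<open>x e\<close> tensor \<open>y\<close>, hence \<open>x\<close>
  tensor \<open>e y\<close>, and \<open>e y = 0\<close>. The zero is written as a pure tensor
  because that is how it appears for coefficient 0 in
  \<open>depth_three_path_algebra\<close>.\<close>

lemma tensor_noncomposable:
  fixes k l :: "'k::field"
  assumes "x \<in> paths Q" "y \<in> paths Q" "snd (snd x) \<noteq> fst y"
  defines "T \<equiv> ring_extension.tensor (path_algebra Q) (top_subalgebra Q)"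
  shows "T [Poly_Mapping.single x k, Poly_Mapping.single y l] = T [0, Poly_Mapping.single y l]"
proof -
  interpret E: ring_extension "path_algebra Q :: (('v, 'e) path \<Rightarrow>\<^sub>0 'k) ring" "top_subalgebra Q"
    by (rule ring_extension_path_algebra)
  let ?e = "diagonal Q (\<lambda>v. if v = snd (snd x) then 1 else 0) :: ('v, 'e) path \<Rightarrow>\<^sub>0 'k"
  have e: "?e \<in> top_subalgebra Q" by (simp add: top_subalgebra_eq)
  have "T [path_mult (Poly_Mapping.single x k) ?e, Poly_Mapping.single y l] =
      T [Poly_Mapping.single x k, path_mult ?e (Poly_Mapping.single y l)]"
    using E.tensor2_balanced[OF _ e, of "Poly_Mapping.single x k" "Poly_Mapping.single y l"] assms
    by simp
  moreover have "T [path_mult 0 ?e, Poly_Mapping.single y l] =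
      T [0, path_mult ?e (Poly_Mapping.single y l)]"
    using E.tensor2_balanced[OF _ e, of "0" "Poly_Mapping.single y l"] assms by simp
  moreover have "path_mult ?e (Poly_Mapping.single y l) = 0"
    using assms by (simp add: diagonal_mult_single)
  moreover have "T [Poly_Mapping.single x k, 0] = \<one>\<^bsub>tensor_power (path_algebra Q) (top_subalgebra Q) 2\<^esub>"
    using E.tensor_zero[of "[Poly_Mapping.single x k]" "[]" 2] assms by simp
  moreover have "T [0, 0] = \<one>\<^bsub>tensor_power (path_algebra Q) (top_subalgebra Q) 2\<^esub>"
    using E.tensor_zero[of "[0]" "[]" 2] assms by simp
  ultimately show ?thesis
    using assms by (simp add: single_mult_diagonal)
qed

end

section \<open>Acyclic quivers and depth three\<close>

locale acyclic_quiver = quiver Q for Q :: "('v, 'e) pre_digraph" +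
  assumes acyclic: "\<nexists>p. cycle p"
begin

text \<open>A nonempty closed walk contains a cycle. Acyclicity enters all later arguments in this
  form; loops are covered as cycles of length one.\<close>

lemma closed_path_trivial:
  assumes "awalk a p a"
  shows "p = []"
proof (rule ccontr)
  assume "p \<noteq> []"
  then have "closed_w p" using assms by (auto simp: closed_w_def)
  then show False using closed_w_imp_cycle acyclic by blast
qed

text \<open>A repeated vertex would cut out a nonempty closed subwalk, so no walk repeats a vertex,
  and a finite digraph has finitely many such walks.\<close>

lemma finite_paths: "finite (paths Q)"
proof -
  have "apath a p b" if p: "awalk a p b" for a p b
  proof (rule ccontr)
    assume "\<not> apath a p b"
    then have "\<not> distinct (awalk_verts a p)"
      using p by (simp add: apath_def)
    then obtain q r s where "p = q @ r @ s" "\<exists>w. awalk w r w" "r \<noteq> []"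
      using awalk_not_distinct_decomp[OF p] by auto
    then show False using closed_path_trivial by blast
  qed
  then have "paths Q \<subseteq> {(a, p, b). apath a p b}"
    by (auto simp: paths_def)
  then show ?thesis
    using apaths_finite_triple finite_subset by blast
qed

lemma tail_neq_head: "e \<in> arcs Q \<Longrightarrow> tail Q e \<noteq> head Q e"
  using arc_implies_awalk[of e] closed_path_trivial[of _ "[e]"] by auto

lemma sum_components:
  assumes "Poly_Mapping.keys f \<subseteq> paths Q"
  shows "(\<Sum>x\<in>paths Q. component x f) = f"
  using assms finite_paths
  by (subst (2) poly_mapping_decompose) (auto simp: component_def in_keys_iff intro!: sum.mono_neutral_right)

lemma depth_three_path_algebra:
  assumes "verts Q \<noteq> {}"
  shows "C_similar (path_algebra Q :: (('v, 'e) path \<Rightarrow>\<^sub>0 'k::field) ring) (top_subalgebra Q)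
    (path_algebra Q\<lparr>carrier := top_subalgebra Q\<rparr>) (path_algebra Q\<lparr>carrier := top_subalgebra Q\<rparr>) 1"
proof -
  let ?A = "path_algebra Q :: (('v, 'e) path \<Rightarrow>\<^sub>0 'k) ring"
  let ?C2 = "tensor_power ?A (top_subalgebra Q) 2"
  interpret E: ring_extension ?A "top_subalgebra Q"
    by (rule ring_extension_path_algebra)
  \<comment> \<open>The coefficient in \<open>f\<close> of the concatenation of \<open>x\<close> and
    \<open>y\<close>, or 0 if they do not compose.\<close>
  define coeff where "coeff x y f =
      (if snd (snd x) = fst y then Poly_Mapping.lookup f (fst x, fst (snd x) @ fst (snd y), snd (snd y)) else 0)"
    for x y :: "('v, 'e) path" and f :: "('v, 'e) path \<Rightarrow>\<^sub>0 'k"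
  \<comment> \<open>The map that sends the path \<open>xy\<close> to \<open>x\<close> tensor
    \<open>y\<close> and every other path to zero. The coefficient is attached to \<open>x\<close>,
    so compatibility with the right action needs \<open>tensor_scalar_swap\<close>.\<close>
  define G where "G x y f = E.tensor [Poly_Mapping.single x (coeff x y f), Poly_Mapping.single y 1]" for x y f
  have coeff_add: "coeff x y (f + g) = coeff x y f + coeff x y g" for x y f g
    by (simp add: coeff_def lookup_add)
  have coeff_left: "coeff x y (path_mult (diagonal Q c) f) = c (fst x) * coeff x y f"
    and coeff_right: "coeff x y (path_mult f (diagonal Q c)) = coeff x y f * c (snd (snd y))"
    if "Poly_Mapping.keys f \<subseteq> paths Q" for x y c f
    using that by (simp_all add: coeff_def lookup_diagonal_mult lookup_mult_diagonal)
  obtain v where "v \<in> verts Q" using assms by blast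
  \<comment> \<open>The stationary path at \<open>v\<close> is a witness.\<close>
  then have "paths Q \<noteq> {}"
    by (auto simp: paths_def awalk_Nil_iff intro!: exI[of _ "[]"])
  then show ?thesis
  proof (rule E.depth_three[OF finite_paths, of component G])
    show "component x f \<in> carrier ?A" if "x \<in> paths Q" "f \<in> carrier ?A" for x f
      using that by (simp add: component_def)
    show "component x (f \<oplus>\<^bsub>?A\<^esub> g) = component x f \<oplus>\<^bsub>?A\<^esub> component x g" for x f g
      by (simp add: component_add)
    show "component x (b \<otimes>\<^bsub>?A\<^esub> f) = b \<otimes>\<^bsub>?A\<^esub> component x f"
      "component x (f \<otimes>\<^bsub>?A\<^esub> b) = component x f \<otimes>\<^bsub>?A\<^esub> b"
      if "x \<in> paths Q" "b \<in> top_subalgebra Q" "f \<in> carrier ?A" for x b f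
      using that by (simp_all add: component_mult)
    show "finsum ?A (\<lambda>x. component x f) (paths Q) = f" if "f \<in> carrier ?A" for f
      using that by (subst finsum_path_algebra) (simp_all add: component_closed sum_components)
    fix x y assume xy: "x \<in> paths Q" "y \<in> paths Q"
    show "G x y f \<in> carrier ?C2" for f
      using xy by (simp add: G_def E.tensor2_closed)
    show "G x y (f \<oplus>\<^bsub>?A\<^esub> g) = G x y f \<otimes>\<^bsub>?C2\<^esub> G x y g" for f g
      using xy E.tensor2_add_left[of "Poly_Mapping.single x (coeff x y f)" "Poly_Mapping.single x (coeff x y g)"
          "Poly_Mapping.single y 1"]
      by (simp add: G_def coeff_add single_add)
    fix b f :: "('v, 'e) path \<Rightarrow>\<^sub>0 'k"
    assume b: "b \<in> top_subalgebra Q" and f: "f \<in> carrier ?A"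
    obtain c where c: "b = diagonal Q c" using b by (auto simp: top_subalgebra_eq)
    have bA: "b \<in> carrier ?A" using b by (rule E.subset)
    show "G x y (b \<otimes>\<^bsub>?A\<^esub> f) = lact ?C2 b (G x y f)"
      using xy f bA E.tensor2_lact[of b "Poly_Mapping.single x (coeff x y f)" "Poly_Mapping.single y 1"]
      by (simp add: G_def c coeff_left diagonal_mult_single)
    show "G x y (f \<otimes>\<^bsub>?A\<^esub> b) = ract ?C2 (G x y f) b"
      using xy f bA E.tensor2_ract[of b "Poly_Mapping.single x (coeff x y f)" "Poly_Mapping.single y 1"]
      by (simp add: G_def c coeff_right single_mult_diagonal tensor_scalar_swap)
  next
    fix x y f g assume xy: "x \<in> paths Q" "y \<in> paths Q"
    show "G x y (component x f \<otimes>\<^bsub>?A\<^esub> component y g) = E.tensor [component x f, component y g]"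
    proof (cases "snd (snd x) = fst y")
      case True
      then have "G x y (component x f \<otimes>\<^bsub>?A\<^esub> component y g) =
          E.tensor [Poly_Mapping.single x (Poly_Mapping.lookup f x * Poly_Mapping.lookup g y), Poly_Mapping.single y 1]"
        by (simp add: G_def component_def path_mult_single path_term_def coeff_def)
      then show ?thesis
        by (simp add: tensor_scalar_swap[OF xy] component_def)
    next
      \<comment> \<open>The product is zero, and so is the tensor of the two components; both are
        rewritten to a pure tensor with left factor 0.\<close>
      case False
      have "G x y (component x f \<otimes>\<^bsub>?A\<^esub> component y g) = E.tensor [0, Poly_Mapping.single y 1]"
        using False by (simp add: G_def coeff_def)
      also have "\<dots> = E.tensor [Poly_Mapping.single x 0, Poly_Mapping.single y (Poly_Mapping.lookup g y)]"
        using tensor_scalar_swap[OF xy, of 0 "Poly_Mapping.lookup g y"] by simp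
      also have "\<dots> = E.tensor [component x f, component y g]"
        using tensor_noncomposable[OF xy False, of "Poly_Mapping.lookup f x" "Poly_Mapping.lookup g y"]
        by (simp add: component_def)
      finally show ?thesis .
    qed
  qed
qed

definition vertex_idempotent :: "'v \<Rightarrow> (('v, 'e) path \<Rightarrow>\<^sub>0 'k::field)"
  where "vertex_idempotent v = diagonal Q (\<lambda>a. if a = v then 1 else 0)"

lemma vertex_idempotent_in: "vertex_idempotent v \<in> top_subalgebra Q"
  by (simp add: vertex_idempotent_def top_subalgebra_eq)

lemma vertex_idempotent_idem: "path_mult (vertex_idempotent v) (vertex_idempotent v) = vertex_idempotent v"
  unfolding vertex_idempotent_def diagonal_mult_diagonal by (rule arg_cong[where f = "diagonal Q"]) auto

lemma lookup_corner:
  assumes "Poly_Mapping.keys f \<subseteq> paths Q"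
  shows "Poly_Mapping.lookup (path_mult (path_mult (vertex_idempotent u) f) (vertex_idempotent v)) (a, p, b) =
    (if a = u \<and> b = v then Poly_Mapping.lookup f (a, p, b) else 0)"
proof -
  have "Poly_Mapping.keys (path_mult (vertex_idempotent u) f) \<subseteq> paths Q"
    unfolding vertex_idempotent_def by (intro keys_path_mult_paths keys_diagonal assms)
  then show ?thesis
    unfolding vertex_idempotent_def
    by (simp add: lookup_mult_diagonal lookup_diagonal_mult[OF assms])
qed

text \<open>By acyclicity a path from \<open>v\<close> to \<open>v\<close> is stationary, and the
  second assumption excludes the stationary path from the support of \<open>f\<close>.\<close>

lemma corner_eq_zero:
  assumes f: "Poly_Mapping.keys f \<subseteq> paths Q" and "\<And>p. (v, p, v) \<in> Poly_Mapping.keys f \<Longrightarrow> p \<noteq> []"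
  shows "path_mult (path_mult (vertex_idempotent v) f) (vertex_idempotent v) = 0"
proof (rule poly_mapping_eqI)
  fix x :: "('v, 'e) path"
  obtain a p b where x: "x = (a, p, b)" by (rule prod_cases3)
  have "(v, p, v) \<notin> Poly_Mapping.keys f"
  proof
    assume *: "(v, p, v) \<in> Poly_Mapping.keys f"
    then have "awalk v p v" using f by (auto simp: paths_def)
    then show False using closed_path_trivial assms(2)[OF *] by blast
  qed
  then show "Poly_Mapping.lookup (path_mult (path_mult (vertex_idempotent v) f) (vertex_idempotent v)) x =
      Poly_Mapping.lookup 0 x"
    by (auto simp: x lookup_corner[OF f] in_keys_iff)
qed

text \<open>Every path in such a product ends with the arcs \<open>q\<close>. For a single arrow
  this makes it nonstationary, which is the premise of \<open>corner_eq_zero\<close>.\<close>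

lemma keys_mult_component:
  assumes "(a, p, b) \<in> Poly_Mapping.keys (path_mult f (component (c, q, d) g))"
  obtains r where "p = r @ q"
  using assms by (rule keys_path_mult) (auto simp: component_def split: if_splits)

lemma keys_component_mult:
  assumes "(a, p, b) \<in> Poly_Mapping.keys (path_mult (component (c, q, d) g) f)"
  obtains r where "p = q @ r"
  using assms by (rule keys_path_mult) (auto simp: component_def split: if_splits)

section \<open>Obstructions from one arrow\<close>

context
  fixes e assumes arc: "e \<in> arcs Q"
begin

abbreviation "arc_path \<equiv> (tail Q e, [e], head Q e)"

lemma arc_path: "arc_path \<in> paths Q"
  using arc by (simp add: paths_def arc_implies_awalk)

lemma not_depth_one_path_algebra:
  "\<not> C_similar (path_algebra Q :: (('v, 'e) path \<Rightarrow>\<^sub>0 'k::field) ring) (top_subalgebra Q)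
    (path_algebra Q\<lparr>carrier := top_subalgebra Q\<rparr>) (path_algebra Q\<lparr>carrier := top_subalgebra Q\<rparr>) 0"
proof -
  let ?A = "path_algebra Q :: (('v, 'e) path \<Rightarrow>\<^sub>0 'k) ring"
  let ?x = "Poly_Mapping.single arc_path 1 :: ('v, 'e) path \<Rightarrow>\<^sub>0 'k"
  interpret E: ring_extension ?A "top_subalgebra Q"
    by (rule ring_extension_path_algebra)
  show ?thesis
  proof (rule E.not_depth_one[of "vertex_idempotent (tail Q e)" "vertex_idempotent (head Q e)" ?x])
    show "vertex_idempotent (tail Q e) \<otimes>\<^bsub>?A\<^esub> ?x \<otimes>\<^bsub>?A\<^esub> vertex_idempotent (head Q e) = ?x"
      using arc_path by (simp add: vertex_idempotent_def diagonal_mult_single single_mult_diagonal)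
    show "?x \<noteq> \<zero>\<^bsub>?A\<^esub>"
      using lookup_single_eq[of arc_path "1::'k"] by (metis lookup_zero path_algebra_simps(4) zero_neq_one)
    show "vertex_idempotent (tail Q e) \<otimes>\<^bsub>?A\<^esub> b \<otimes>\<^bsub>?A\<^esub> vertex_idempotent (head Q e) = \<zero>\<^bsub>?A\<^esub>"
      if "b \<in> top_subalgebra Q" for b
    proof -
      obtain c where c: "b = diagonal Q c" using \<open>b \<in> top_subalgebra Q\<close> by (auto simp: top_subalgebra_eq)
      \<comment> \<open>The arrow is no loop, so the indicator functions of its two ends have
        product zero.\<close>
      have "diagonal Q (\<lambda>a. (if a = tail Q e then 1 else 0) * c a * (if a = head Q e then 1 else 0)) = diagonal Q (\<lambda>_. 0)"
        using tail_neq_head[OF arc] by (intro arg_cong[where f = "diagonal Q"]) auto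
      then show ?thesis
        by (simp add: c vertex_idempotent_def diagonal_mult_diagonal) (simp add: diagonal_def)
    qed
  qed (use arc_path vertex_idempotent_in in simp_all)
qed

lemma component_arc_path: "component arc_path (Poly_Mapping.single arc_path 1) = Poly_Mapping.single arc_path 1"
  by (simp add: component_def)

lemma not_right_depth_two_path_algebra:
  "\<not> C_similar (path_algebra Q :: (('v, 'e) path \<Rightarrow>\<^sub>0 'k::field) ring) (top_subalgebra Q)
    (path_algebra Q) (path_algebra Q\<lparr>carrier := top_subalgebra Q\<rparr>) 1"
proof -
  let ?A = "path_algebra Q :: (('v, 'e) path \<Rightarrow>\<^sub>0 'k) ring"
  let ?x = "Poly_Mapping.single arc_path 1 :: ('v, 'e) path \<Rightarrow>\<^sub>0 'k"
  interpret E: ring_extension ?A "top_subalgebra Q"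
    by (rule ring_extension_path_algebra)
  show ?thesis
  proof (rule E.not_right_depth_two[of "component arc_path" "vertex_idempotent (head Q e)" ?x])
    show "?x \<otimes>\<^bsub>?A\<^esub> vertex_idempotent (head Q e) = ?x"
      using arc_path by (simp add: vertex_idempotent_def single_mult_diagonal)
    show "component arc_path ?x \<noteq> \<zero>\<^bsub>?A\<^esub>"
      using lookup_single_eq[of arc_path "1::'k"]
      by (metis component_arc_path lookup_zero path_algebra_simps(4) zero_neq_one)
    fix u v assume uv: "u \<in> carrier ?A" "v \<in> carrier ?A"
    have "path_mult (path_mult (vertex_idempotent (head Q e)) (path_mult u (component arc_path v)))
        (vertex_idempotent (head Q e)) = 0"
    \<comment> \<open>All paths in the support of \<open>u\<close> times a multiple of the arrow end
      with \<open>e\<close>, so none of them is stationary at the head.\<close>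
    proof (rule corner_eq_zero)
      show "Poly_Mapping.keys (path_mult u (component arc_path v)) \<subseteq> paths Q"
        using uv arc_path by (intro keys_path_mult_paths component_closed) simp_all
    qed (auto elim: keys_mult_component)
    then show "vertex_idempotent (head Q e) \<otimes>\<^bsub>?A\<^esub> (u \<otimes>\<^bsub>?A\<^esub> component arc_path v) \<otimes>\<^bsub>?A\<^esub>
        vertex_idempotent (head Q e) = \<zero>\<^bsub>?A\<^esub>"
      by simp
  qed (use arc_path vertex_idempotent_in in
      \<open>simp_all add: component_closed component_add component_mult vertex_idempotent_idem\<close>)
qed

lemma not_left_depth_two_path_algebra:
  "\<not> C_similar (path_algebra Q :: (('v, 'e) path \<Rightarrow>\<^sub>0 'k::field) ring) (top_subalgebra Q)
    (path_algebra Q\<lparr>carrier := top_subalgebra Q\<rparr>) (path_algebra Q) 1"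
proof -
  let ?A = "path_algebra Q :: (('v, 'e) path \<Rightarrow>\<^sub>0 'k) ring"
  let ?x = "Poly_Mapping.single arc_path 1 :: ('v, 'e) path \<Rightarrow>\<^sub>0 'k"
  interpret E: ring_extension ?A "top_subalgebra Q"
    by (rule ring_extension_path_algebra)
  show ?thesis
  proof (rule E.not_left_depth_two[of "component arc_path" "vertex_idempotent (tail Q e)" ?x])
    show "vertex_idempotent (tail Q e) \<otimes>\<^bsub>?A\<^esub> ?x = ?x"
      using arc_path by (simp add: vertex_idempotent_def diagonal_mult_single)
    show "component arc_path ?x \<noteq> \<zero>\<^bsub>?A\<^esub>"
      using lookup_single_eq[of arc_path "1::'k"]
      by (metis component_arc_path lookup_zero path_algebra_simps(4) zero_neq_one)
    fix u v assume uv: "u \<in> carrier ?A" "v \<in> carrier ?A"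
    have "path_mult (path_mult (vertex_idempotent (tail Q e)) (path_mult (component arc_path u) v))
        (vertex_idempotent (tail Q e)) = 0"
    proof (rule corner_eq_zero)
      show "Poly_Mapping.keys (path_mult (component arc_path u) v) \<subseteq> paths Q"
        using uv arc_path by (intro keys_path_mult_paths component_closed) simp_all
    qed (auto elim: keys_component_mult)
    then show "vertex_idempotent (tail Q e) \<otimes>\<^bsub>?A\<^esub> (component arc_path u \<otimes>\<^bsub>?A\<^esub> v) \<otimes>\<^bsub>?A\<^esub>
        vertex_idempotent (tail Q e) = \<zero>\<^bsub>?A\<^esub>"
      by simp
  qed (use arc_path vertex_idempotent_in in
      \<open>simp_all add: component_closed component_add component_mult vertex_idempotent_idem\<close>)
qed

end

end

text \<open>The values below 3 that could be attained are 1, which is odd depth with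
  \<open>m = 0\<close>, and 2, which is left or right depth with \<open>m = 1\<close>; these are the
  three excluded cases.\<close>

lemma min_depth_eq_three:
  assumes "C_similar A B (A\<lparr>carrier := B\<rparr>) (A\<lparr>carrier := B\<rparr>) 1"
    and "\<not> C_similar A B (A\<lparr>carrier := B\<rparr>) (A\<lparr>carrier := B\<rparr>) 0"
    and "\<not> C_similar A B A (A\<lparr>carrier := B\<rparr>) 1" "\<not> C_similar A B (A\<lparr>carrier := B\<rparr>) A 1"
  shows "min_depth B A = 3"
proof -
  have "k \<ge> 3" if k: "has_odd_depth A B k \<or> has_left_even_depth A B k \<or> has_right_even_depth A B k" for k
  proof -
    obtain m where "k = 2 * m + 1 \<and> m \<noteq> 0 \<or> k = 2 * m \<and> m \<ge> 1 \<and> m \<noteq> 1"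
      using k assms(2-) unfolding has_odd_depth_def has_left_even_depth_def has_right_even_depth_def
      by metis
    then show ?thesis by auto
  qed
  moreover have "has_odd_depth A B 3"
    using assms(1) by (auto simp: has_odd_depth_def intro!: exI[of _ 1])
  ultimately have "min_depth B A = enat 3"
    unfolding min_depth_def by (intro antisym Inf_lower Inf_greatest) auto
  then show ?thesis by (simp add: numeral_eq_enat)
qed

theorem theorem4p2:
  fixes Q :: "('v, 'e) pre_digraph"
  assumes "fin_digraph Q"
    and "connected Q"
    and "\<not> (\<exists>p. pre_digraph.cycle Q p)"
    and "card (verts Q) > 1"
  shows "min_depth (top_subalgebra Q)
           (path_algebra Q :: (('v, 'e) path \<Rightarrow>\<^sub>0 'k::alg_closed_field) ring) = 3"
proof -
  interpret acyclic_quiver Q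
    using assms(1,3) by (simp add: acyclic_quiver_def acyclic_quiver_axioms_def quiver_def)
  \<comment> \<open>Connectedness and a second vertex enter through this arrow, from which all three
    obstructions are obtained.\<close>
  obtain e where e: "e \<in> arcs Q"
    using connected_arcs_nonempty[OF assms(1,2,4)] by blast
  have "verts Q \<noteq> {}"
    using assms(4) by auto
  then show ?thesis
    by (intro min_depth_eq_three depth_three_path_algebra not_depth_one_path_algebra[OF e]
        not_right_depth_two_path_algebra[OF e] not_left_depth_two_path_algebra[OF e])
qed

end
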